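(* Suppose that $x\mapsto F(-x)$ is regularly varying at infinity with index $-\alpha$ for some $\alpha\in(0,1)$, and that $x\mapsto\overline F(x)$ is regularly varying at infinity with index $-\beta$ for some $\beta>\alpha$. If $T<\infty$, also suppose that $x\mapsto F(x+\Delta)$ is regularly varying at infinity. Then for any sequence $\{x_n\}$ with $nF(-x_n)=o(1)$, we have $\mathsf{P}\{S_n\in x+\Delta\}\sim nF(x+\Delta)$ as $n\to\infty$ uniformly for $x\ge x_n$, that is, $$\lim_{n\to\infty}\ \sup_{x\ge x_n}\left|\frac{\mathsf{P}\{S_n\in x+\Delta\}}{nF(x+\Delta)}-1\right|=0 .$$
   Context: Let $\xi,\xi_1,\xi_2,\dots$ be i.i.d. real random variables with distribution function $F(x)=\mathsf{P}\{\xi\le x\}$, and $S_n=\xi_1+\cdots+\xi_n$. Fix $T\in(0,\infty]$; put $\Delta=(0,T]$ if $T<\infty$ and $\Delta=(0,\infty)$ if $T=\infty$, and $F(x+\Delta)=\mathsf{P}\{\xi\in x+\Delta\}$ (so $F(x+\Delta)=\overline F(x)$ when $T=\infty$). Write $\overline F(x)=\mathsf{P}\{\xi>x\}$. *)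

theory Defs
  imports "HOL-Probability.Probability" "HOL-Library.Landau_Symbols"
begin

text \<open>Regular variation in the sense of Karamata; measurability and positivity are
  required on some neighbourhood of infinity only.\<close>

definition regularly_varying :: "(real \<Rightarrow> real) \<Rightarrow> real \<Rightarrow> bool" where
  "regularly_varying f \<rho> \<longleftrightarrow>
     (\<exists>A. f \<in> borel_measurable (restrict_space borel {A..}) \<and> (\<forall>x\<ge>A. f x > 0)) \<and>
     (\<forall>c>0. ((\<lambda>x. f (c * x) / f x) \<longlongrightarrow> c powr \<rho>) at_top)"

text \<open>\<open>Delta T\<close> is \<open>(0, T]\<close> for \<open>T < \<infinity>\<close> and \<open>(0, \<infinity>)\<close> for \<open>T = \<infinity>\<close>;
  \<open>shifted_Delta T x\<close> is \<open>x + \<Delta>\<close>.\<close>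

definition Delta :: "ereal \<Rightarrow> real set" where
  "Delta T = {y. 0 < y \<and> ereal y \<le> T}"

definition shifted_Delta :: "ereal \<Rightarrow> real \<Rightarrow> real set" where
  "shifted_Delta T x = (\<lambda>y. x + y) ` Delta T"

text \<open>A family \<open>\<xi> 0, \<xi> 1, \<xi> 2, \<dots>\<close> of i.i.d. real random variables on the probability
  space \<open>M\<close>. Here \<open>\<xi> 0\<close> is the generic copy, which does not enter the partial sums.\<close>

definition iid_sequence :: "'a measure \<Rightarrow> (nat \<Rightarrow> 'a \<Rightarrow> real) \<Rightarrow> bool" where
  "iid_sequence M \<xi> \<longleftrightarrow>
     prob_space M \<and>
     prob_space.indep_vars M (\<lambda>_. borel) \<xi> UNIV \<and>
     (\<forall>i. distr M borel (\<xi> i) = distr M borel (\<xi> 0))"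

definition partial_sum :: "(nat \<Rightarrow> 'a \<Rightarrow> real) \<Rightarrow> nat \<Rightarrow> 'a \<Rightarrow> real" where
  "partial_sum \<xi> n \<omega> = (\<Sum>i=1..n. \<xi> i \<omega>)"

end

theory Submission
  imports Defs "HOL-Real_Asymp.Real_Asymp"
begin

text \<open>
  Put \<open>f(x) = P(\<xi> \<in> x + \<Delta>)\<close>. The event \<open>S\<^sub>n \<in> x + \<Delta>\<close> is split according to the size of the
  largest summand. If the sum of the absolute values of the other \<open>n - 1\<close> summands is at most
  \<open>\<epsilon> x\<close>, the remaining one has to hit a window at distance at most \<open>\<epsilon> x\<close> from \<open>x + \<Delta>\<close>, which
  has probability close to \<open>f(x)\<close> by the uniform convergence theorem; these \<open>n\<close> events are
  disjoint and give the main term \<open>n f(x)\<close>, because the truncated first moment of \<open>\<bar>\<xi>\<bar>\<close> is of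
  order \<open>x F(-x)\<close> and \<open>n F(-x) = o(1)\<close>. If some summand exceeds \<open>\<eta> x\<close> but the others are not small,
  the same considerations leave \<open>o(n f(x))\<close>. Finally, if all summands are at most \<open>\<eta> x\<close>,
  the exponential Chebyshev inequality with parameter \<open>K ln x / x\<close> gives \<open>x\<^sup>-\<^sup>K\<close>, uniformly in \<open>n\<close>:
  since the left tail is heavier than the right one and \<open>\<alpha> < 1\<close>, the truncated moment generating
  function is at most \<open>1\<close> for small \<open>\<eta>\<close>.
\<close>

subsection \<open>Regular variation\<close>

text \<open>Pointwise convergence turned into convergence in measure: the sets \<open>V n\<close>,
  on which the increment stays below \<open>e\<close> from index \<open>n\<close> onwards, increase
  to the whole interval, so continuity from below applies, and \<open>V n\<close> is contained in
  \<open>Z n\<close>.\<close>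

lemma translate_difference_measure:
  fixes k :: "real \<Rightarrow> real"
  assumes [measurable]: "k \<in> borel_measurable borel"
    and lim: "\<And>u. ((\<lambda>t. k (t + u) - k t) \<longlongrightarrow> 0) at_top"
    and s: "filterlim s at_top sequentially" and e: "e > 0"
  shows "(\<lambda>n. measure lebesgue {u\<in>{0..2}. \<bar>k (s n + u) - k (s n)\<bar> < e}) \<longlonglongrightarrow> 2"
proof -
  define V where "V n = {u\<in>{0..2::real}. \<forall>m\<ge>n. \<bar>k (s m + u) - k (s m)\<bar> < e}" for n
  define Z where "Z n = {u\<in>{0..2::real}. \<bar>k (s n + u) - k (s n)\<bar> < e}" for n
  have Vb: "V n \<in> sets borel" for n
    unfolding V_def by measurable
  have Zb: "Z n \<in> sets borel" for n
    unfolding Z_def by measurable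
  have UV: "(\<Union>n. V n) = {0..2}"
  proof -
    have "u \<in> (\<Union>n. V n)" if "u \<in> {0..2}" for u
    proof -
      have "(\<lambda>n. k (s n + u) - k (s n)) \<longlonglongrightarrow> 0"
        using filterlim_compose[OF lim s] .
      then have "eventually (\<lambda>n. \<bar>k (s n + u) - k (s n)\<bar> < e) sequentially"
        using e by (auto simp: tendsto_iff dist_real_def)
      then show ?thesis
        using that by (auto simp: eventually_sequentially V_def)
    qed
    then show ?thesis by (auto simp: V_def)
  qed
  have "(\<lambda>n. measure lebesgue (V n)) \<longlonglongrightarrow> measure lebesgue (\<Union>n. V n)"
    by (rule Lim_measure_incseq) (use Vb in \<open>auto simp: UV, auto simp: incseq_def V_def\<close>)
  then have VL: "(\<lambda>n. measure lebesgue (V n)) \<longlonglongrightarrow> 2"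
    by (simp add: UV)
  show ?thesis unfolding Z_def[symmetric]
  proof (rule tendsto_sandwich[OF _ _ VL tendsto_const])
    have Zf: "Z n \<in> lmeasurable" for n
      by (rule fmeasurableI2[of "{0..2}"]) (use Zb in \<open>auto simp: Z_def\<close>)
    show "\<forall>\<^sub>F n in sequentially. measure lebesgue (V n) \<le> measure lebesgue (Z n)"
      by (intro always_eventually allI measure_mono_fmeasurable) (use Vb Zf in \<open>auto simp: V_def Z_def\<close>)
    have "measure lebesgue (Z n) \<le> measure lebesgue {0..2::real}" for n
      by (rule measure_mono_fmeasurable) (use Zb in \<open>auto simp: Z_def\<close>)
    then show "\<forall>\<^sub>F n in sequentially. measure lebesgue (Z n) \<le> 2"
      by simp
  qed
qed

text \<open>If uniformity failed along \<open>t n\<close>, \<open>u n\<close>, the increments from \<open>t n\<close> and from \<open>t n + u n\<close> would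
  both be small on subsets of \<open>{0..3}\<close> of measure more than \<open>3 / 2\<close>, which have to meet.\<close>

lemma uniform_convergence_additive:
  fixes k :: "real \<Rightarrow> real"
  assumes [measurable]: "k \<in> borel_measurable borel"
    and lim: "\<And>u. ((\<lambda>t. k (t + u) - k t) \<longlongrightarrow> 0) at_top"
    and e: "e > 0"
  shows "\<exists>T. \<forall>t\<ge>T. \<forall>u\<in>{0..1}. \<bar>k (t + u) - k t\<bar> < e"
proof (rule ccontr)
  assume "\<not> ?thesis"
  then have "\<forall>n::nat. \<exists>t u. t \<ge> real n \<and> u \<in> {0..1} \<and> \<bar>k (t + u) - k t\<bar> \<ge> e"
    by (meson not_less)
  then obtain t u where tu: "\<And>n::nat. t n \<ge> real n" "\<And>n. u n \<in> {0..1}"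
      "\<And>n. \<bar>k (t n + u n) - k (t n)\<bar> \<ge> e"
    by metis
  have t_lim: "filterlim t at_top sequentially"
    by (rule filterlim_at_top_mono[OF filterlim_real_sequentially]) (use tu in auto)
  have tu_lim: "filterlim (\<lambda>n. t n + u n) at_top sequentially"
    by (rule filterlim_at_top_mono[OF t_lim]) (use tu(2) in auto)
  define V where "V n = {v\<in>{0..2}. \<bar>k (t n + v) - k (t n)\<bar> < e / 2}" for n
  define W where "W n = {v\<in>{0..2}. \<bar>k (t n + u n + v) - k (t n + u n)\<bar> < e / 2}" for n
  have V2: "(\<lambda>n. measure lebesgue (V n)) \<longlonglongrightarrow> 2"
    unfolding V_def by (rule translate_difference_measure) (use lim t_lim e in auto)
  have W2: "(\<lambda>n. measure lebesgue (W n)) \<longlonglongrightarrow> 2"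
    unfolding W_def by (rule translate_difference_measure) (use lim tu_lim e in auto)
  have "\<forall>\<^sub>F n in sequentially. measure lebesgue (V n) > 3 / 2 \<and> measure lebesgue (W n) > 3 / 2"
    using order_tendstoD(1)[OF V2, of "3/2"] order_tendstoD(1)[OF W2, of "3/2"]
    by (auto intro: eventually_conj)
  then obtain n where n: "measure lebesgue (V n) > 3 / 2" "measure lebesgue (W n) > 3 / 2"
    by (auto simp: eventually_sequentially)
  \<comment> \<open>Translation by \<open>u n\<close> turns displacements from
    \<open>t n + u n\<close> into displacements from \<open>t n\<close>, so that \<open>W'\<close>
    is comparable with \<open>V n\<close>; the measure does not change.\<close>
  define W' where "W' = (\<lambda>v. u n + v) ` W n"
  have Vb: "V n \<in> sets borel" unfolding V_def by measurable
  have Wb: "W n \<in> sets borel" unfolding W_def by measurable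
  have Vf: "V n \<in> lmeasurable"
    by (rule fmeasurableI2[of "{0..2}"]) (use Vb in \<open>auto simp: V_def\<close>)
  have Wf: "W n \<in> lmeasurable"
    by (rule fmeasurableI2[of "{0..2}"]) (use Wb in \<open>auto simp: W_def\<close>)
  have W'f: "W' \<in> lmeasurable"
    unfolding W'_def by (rule measurable_translation[OF Wf])
  have W'm: "measure lebesgue W' = measure lebesgue (W n)"
    unfolding W'_def by (rule measure_translation)
  have "V n \<inter> W' \<noteq> {}"
  proof
    assume dis: "V n \<inter> W' = {}"
    have "measure lebesgue (V n \<union> W') = measure lebesgue (V n) + measure lebesgue W'"
      by (rule measure_Union) (use Vf W'f dis in \<open>auto simp: fmeasurable_def\<close>)
    moreover have "V n \<union> W' \<subseteq> {0..3}"
      using tu(2)[of n] by (fastforce simp: V_def W'_def W_def)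
    then have "measure lebesgue (V n \<union> W') \<le> measure lebesgue {0..3::real}"
      by (rule measure_mono_fmeasurable)
        (use Vf W'f in \<open>auto simp: fmeasurable_def\<close>)
    ultimately show False using n W'm by simp
  qed
  then obtain w where "u n + w \<in> V n" "w \<in> W n" by (auto simp: W'_def)
  then have "\<bar>k (t n + u n + w) - k (t n)\<bar> < e / 2" "\<bar>k (t n + u n + w) - k (t n + u n)\<bar> < e / 2"
    by (auto simp: V_def W_def add.assoc)
  then show False using tu(3)[of n] by linarith
qed

lemma regularly_varying_eventually_pos:
  "regularly_varying f \<rho> \<Longrightarrow> \<forall>\<^sub>F x in at_top. f x > 0"
  by (auto simp: regularly_varying_def eventually_at_top_linorder)

text \<open>In the coordinate \<open>t = ln x\<close> regular variation says that
  \<open>ln (f (exp t)) - \<rho> * t\<close> has vanishing increments, and the additive version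
  applies. Since \<open>ln 2 < 1\<close>, displacements in \<open>{0..1}\<close> cover all
  \<open>y\<close> up to \<open>2 * x\<close>.\<close>

lemma regularly_varying_uniform:
  assumes rv: "regularly_varying f \<rho>" and e: "e > 0"
  shows "\<exists>X>0. \<forall>x\<ge>X. \<forall>y\<in>{x..2*x}. \<bar>ln (f y) - ln (f x) - \<rho> * (ln y - ln x)\<bar> < e"
proof -
  obtain A where A: "f \<in> borel_measurable (restrict_space borel {A..})" "\<And>x. x \<ge> A \<Longrightarrow> f x > 0"
    using rv by (auto simp: regularly_varying_def)
  \<comment> \<open>Measurability and positivity of \<open>f\<close> are known on
    \<open>{A..}\<close> only; the value 1 elsewhere makes \<open>g\<close> Borel on the whole line
    and leaves the behaviour at infinity unchanged.\<close>
  define g where "g x = (if x \<in> {A..} then f x else 1)" for x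
  have [measurable]: "g \<in> borel_measurable borel"
    unfolding g_def using A(1) by (subst (asm) measurable_restrict_space_iff[where c = 1]) (auto)
  define k where "k t = ln (g (exp t)) - \<rho> * t" for t
  have [measurable]: "k \<in> borel_measurable borel"
    unfolding k_def by measurable
  have lim: "((\<lambda>t. k (t + u) - k t) \<longlongrightarrow> 0) at_top" for u
  proof -
    have "((\<lambda>x. f (exp u * x) / f x) \<longlongrightarrow> exp u powr \<rho>) at_top"
      using rv by (auto simp: regularly_varying_def)
    then have "((\<lambda>t. f (exp u * exp t) / f (exp t)) \<longlongrightarrow> exp u powr \<rho>) at_top"
      by (rule filterlim_compose) (rule exp_at_top)
    then have "((\<lambda>t. ln (f (exp u * exp t) / f (exp t)) - \<rho> * u) \<longlongrightarrow> ln (exp u powr \<rho>) - \<rho> * u) at_top"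
      by (intro tendsto_intros) auto
    then have *: "((\<lambda>t. ln (f (exp u * exp t) / f (exp t)) - \<rho> * u) \<longlongrightarrow> 0) at_top"
      by (simp add: ln_powr)
    have ev1: "\<forall>\<^sub>F t in at_top. exp t \<ge> A"
      using exp_at_top by (simp add: filterlim_at_top)
    have ev2: "\<forall>\<^sub>F t in at_top. exp (t + u) \<ge> A"
      using filterlim_compose[OF exp_at_top filterlim_tendsto_add_at_top[OF tendsto_const[of u] filterlim_ident]]
      by (simp add: filterlim_at_top add.commute)
    have "\<forall>\<^sub>F t in at_top. ln (f (exp u * exp t) / f (exp t)) - \<rho> * u = k (t + u) - k t"
      using ev1 ev2
    proof eventually_elim
      case (elim t)
      have p: "f (exp t) > 0" "f (exp (t + u)) > 0" using elim A(2) by auto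
      have "exp u * exp t = exp (t + u)" by (simp add: exp_add)
      then show ?case using elim p by (simp add: k_def g_def ln_div algebra_simps)
    qed
    then show ?thesis using * by (rule Lim_transform_eventually[rotated])
  qed
  obtain T where T: "\<And>t u. t \<ge> T \<Longrightarrow> u \<in> {0..1} \<Longrightarrow> \<bar>k (t + u) - k t\<bar> < e"
    using uniform_convergence_additive[of k, OF _ lim e] \<open>k \<in> borel_measurable borel\<close> by blast
  define X where "X = max (exp T) (max A 1)"
  show ?thesis
  proof (intro exI[of _ X] conjI allI impI ballI)
    show "X > 0" by (simp add: X_def)
    fix x y assume x: "X \<le> x" and y: "y \<in> {x..2*x}"
    have x0: "x > 0" "x \<ge> A" "y \<ge> A" "y > 0" "exp T \<le> x" using x y by (auto simp: X_def)
    have "ln (exp T) \<le> ln x" using x0 by (subst ln_le_cancel_iff) auto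
    then have lx: "ln x \<ge> T" by simp
    have "ln y \<le> ln (2 * x)" using y x0 by simp
    also have "\<dots> = ln 2 + ln x" using x0 by (simp add: ln_mult)
    finally have "ln y - ln x \<in> {0..1}"
      using y x0 ln_2_less_1 by auto
    from T[OF lx this] show "\<bar>ln (f y) - ln (f x) - \<rho> * (ln y - ln x)\<bar> < e"
      using x0 by (simp add: k_def g_def algebra_simps)
  qed
qed

text \<open>Potter's bounds in logarithmic form; for \<open>y \<le> 2 * x\<close> they contain the uniform
  convergence theorem.\<close>

lemma regularly_varying_Potter:
  assumes rv: "regularly_varying f \<rho>" and d: "d > 0"
  shows "\<exists>X>0. \<forall>x\<ge>X. f x > 0 \<and>
    (\<forall>y\<ge>x. \<bar>ln (f y) - ln (f x) - \<rho> * (ln y - ln x)\<bar> \<le> d * (1 + ln y - ln x))"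
proof -
  have d2: "d * ln 2 > 0" using d by simp
  obtain X1 where X1: "X1 > 0" "\<And>x y. x \<ge> X1 \<Longrightarrow> y \<in> {x..2*x} \<Longrightarrow>
      \<bar>ln (f y) - ln (f x) - \<rho> * (ln y - ln x)\<bar> < d * ln 2"
    using regularly_varying_uniform[OF rv d2] by metis
  obtain X2 where X2: "\<And>x. x \<ge> X2 \<Longrightarrow> f x > 0"
    using regularly_varying_eventually_pos[OF rv] by (auto simp: eventually_at_top_linorder)
  \<comment> \<open>Induction on the number of doublings. Each full doubling costs at most
    \<open>d * ln 2\<close>, which is \<open>d\<close> times the growth of \<open>ln y\<close>; the
    extra \<open>ln 2\<close> in the bound pays for the incomplete one.\<close>
  have step: "\<bar>ln (f y) - ln (f x) - \<rho> * (ln y - ln x)\<bar> \<le> d * (ln 2 + ln y - ln x)"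
    if "x \<ge> X1" "y \<ge> x" "y \<le> 2 ^ n * x" for x y and n :: nat
    using that
  proof (induction n arbitrary: y)
    case 0
    then have "y = x" by simp
    then show ?case using d by simp
  next
    case (Suc n)
    have x0: "x > 0" using Suc.prems X1(1) by linarith
    show ?case
    proof (cases "y \<le> 2 * x")
      case True
      have "\<bar>ln (f y) - ln (f x) - \<rho> * (ln y - ln x)\<bar> \<le> d * ln 2"
        using X1(2)[of x y] Suc.prems True by simp
      also have "\<dots> \<le> d * (ln 2 + ln y - ln x)"
        using d Suc.prems x0 by simp
      finally show ?thesis .
    next
      case False
      have IH: "\<bar>ln (f (y/2)) - ln (f x) - \<rho> * (ln (y/2) - ln x)\<bar> \<le> d * (ln 2 + ln (y/2) - ln x)"
        by (rule Suc.IH) (use False Suc.prems in auto)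
      have S: "\<bar>ln (f y) - ln (f (y/2)) - \<rho> * (ln y - ln (y/2))\<bar> < d * ln 2"
        by (rule X1(2)) (use False Suc.prems x0 in auto)
      have l: "ln (y/2) = ln y - ln 2" using False x0 by (simp add: ln_div)
      have "\<rho> * (ln (y/2) - ln x) = \<rho> * (ln y - ln x) - \<rho> * (ln y - ln (y/2))"
        "d * (ln 2 + ln y - ln x) = d * (ln 2 + ln (y/2) - ln x) + d * ln 2"
        unfolding l by (simp_all add: algebra_simps)
      then show ?thesis using IH S by linarith
    qed
  qed
  have l2: "ln 2 \<le> (1::real)" using ln_2_less_1 by simp
  have "\<bar>ln (f y) - ln (f x) - \<rho> * (ln y - ln x)\<bar> \<le> d * (1 + ln y - ln x)"
    if "x \<ge> X1" "y \<ge> x" for x y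
  proof -
    obtain n where "y / x < 2 ^ n" using real_arch_pow[of 2 "y/x"] by auto
    then have "y \<le> 2 ^ n * x" using that X1(1) by (simp add: field_simps)
    from step[OF that this] have "\<bar>ln (f y) - ln (f x) - \<rho> * (ln y - ln x)\<bar> \<le> d * (ln 2 + ln y - ln x)" .
    also have "\<dots> \<le> d * (1 + ln y - ln x)"
      by (rule mult_left_mono) (use d l2 in auto)
    finally show ?thesis .
  qed
  then show ?thesis
    using X1(1) X2 by (intro exI[of _ "max X1 X2"]) auto
qed

section \<open>Consequences of Potter's bounds: power bounds, almost monotonicity, insensitivity to
  small shifts\<close>

text \<open>Potter's bound from a fixed base point \<open>X\<close>, with \<open>d\<close> half the
  gap between the exponents, has slope \<rho> + d = \<sigma> - d in \<open>ln y\<close>; the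
  remaining \<open>d * ln y\<close> eventually absorbs the constants. The lower bound below is the
  mirror image.\<close>

lemma regularly_varying_eventually_le_powr:
  assumes rv: "regularly_varying f \<rho>" and s: "\<rho> < \<sigma>"
  shows "\<forall>\<^sub>F x in at_top. f x \<le> x powr \<sigma>"
proof -
  define d where "d = (\<sigma> - \<rho>) / 2"
  have d: "d > 0" "\<rho> = \<sigma> - 2 * d" using s by (auto simp: d_def field_simps)
  obtain X where X: "X > 0" "\<And>x. x \<ge> X \<Longrightarrow> f x > 0"
    "\<And>y. y \<ge> X \<Longrightarrow> \<bar>ln (f y) - ln (f X) - \<rho> * (ln y - ln X)\<bar> \<le> d * (1 + ln y - ln X)"
    using regularly_varying_Potter[OF rv d(1)] by (metis order_refl)
  have "\<forall>\<^sub>F y::real in at_top. ln y \<ge> (ln (f X) - \<rho> * ln X + d - d * ln X) / d"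
    using ln_at_top unfolding filterlim_at_top by blast
  moreover have "\<forall>\<^sub>F y in at_top. y \<ge> X" by (rule eventually_ge_at_top)
  ultimately show ?thesis
  proof eventually_elim
    case (elim y)
    have "ln (f X) - \<rho> * ln X + d - d * ln X \<le> d * ln y"
      using elim(1) d(1) by (simp add: field_simps)
    moreover have "ln (f y) \<le> ln (f X) + \<rho> * (ln y - ln X) + d * (1 + ln y - ln X)"
      using X(3)[OF elim(2)] by linarith
    ultimately have "ln (f y) \<le> \<sigma> * ln y" unfolding d(2) by (simp add: algebra_simps)
    then have "exp (ln (f y)) \<le> exp (\<sigma> * ln y)" by simp
    then show ?case using X elim by (simp add: powr_def)
  qed
qed

lemma regularly_varying_eventually_ge_powr:
  assumes rv: "regularly_varying f \<rho>" and s: "\<sigma> < \<rho>"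
  shows "\<forall>\<^sub>F x in at_top. f x \<ge> x powr \<sigma>"
proof -
  define d where "d = (\<rho> - \<sigma>) / 2"
  have d: "d > 0" "\<rho> = \<sigma> + 2 * d" using s by (auto simp: d_def field_simps)
  obtain X where X: "X > 0" "\<And>x. x \<ge> X \<Longrightarrow> f x > 0"
    "\<And>y. y \<ge> X \<Longrightarrow> \<bar>ln (f y) - ln (f X) - \<rho> * (ln y - ln X)\<bar> \<le> d * (1 + ln y - ln X)"
    using regularly_varying_Potter[OF rv d(1)] by (metis order_refl)
  have "\<forall>\<^sub>F y::real in at_top. ln y \<ge> (d - d * ln X - ln (f X) + \<rho> * ln X) / d"
    using ln_at_top unfolding filterlim_at_top by blast
  moreover have "\<forall>\<^sub>F y in at_top. y \<ge> X" by (rule eventually_ge_at_top)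
  ultimately show ?thesis
  proof eventually_elim
    case (elim y)
    have "d - d * ln X - ln (f X) + \<rho> * ln X \<le> d * ln y"
      using elim(1) d(1) by (simp add: field_simps)
    moreover have "ln (f y) \<ge> ln (f X) + \<rho> * (ln y - ln X) - d * (1 + ln y - ln X)"
      using X(3)[OF elim(2)] by linarith
    ultimately have "ln (f y) \<ge> \<sigma> * ln y" unfolding d(2) by (simp add: algebra_simps)
    then have "exp (ln (f y)) \<ge> exp (\<sigma> * ln y)" by simp
    then show ?case using X elim by (simp add: powr_def)
  qed
qed

text \<open>Potter's bound with d = -\<rho> cancels the slope exactly and leaves the factor exp
  (-\<rho>). This stands in for monotonicity, which window probabilities may lack when
  \<open>T\<close> is finite.\<close>

lemma regularly_varying_almost_decreasing:
  assumes rv: "regularly_varying f \<rho>" and neg: "\<rho> < 0"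
  shows "\<exists>C>0. \<exists>X. \<forall>x\<ge>X. \<forall>y\<ge>x. f y \<le> C * f x"
proof -
  obtain X where X: "X > 0" "\<And>x. x \<ge> X \<Longrightarrow> f x > 0"
    "\<And>x y. x \<ge> X \<Longrightarrow> y \<ge> x \<Longrightarrow> \<bar>ln (f y) - ln (f x) - \<rho> * (ln y - ln x)\<bar> \<le> - \<rho> * (1 + ln y - ln x)"
    using regularly_varying_Potter[OF rv, of "-\<rho>"] neg by auto
  show ?thesis
  proof (rule exI[of _ "exp (-\<rho>)"], intro conjI exI[of _ X] allI impI)
    fix x y assume "X \<le> x" "x \<le> y"
    then have "ln (f y) \<le> ln (f x) + (- \<rho>)" using X(3)[of x y] by (simp add: algebra_simps)
    then have "exp (ln (f y)) \<le> exp (ln (f x) + (- \<rho>))" by (simp only: exp_le_cancel_iff)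
    then show "f y \<le> exp (-\<rho>) * f x" using X(2) \<open>X \<le> x\<close> \<open>x \<le> y\<close> by (simp only: exp_add) (simp add: mult.commute)
  qed simp
qed

text \<open>If \<open>y / x\<close> is close to 1, both the power part and Potter's error term in
  \<open>ln (f y) - ln (f x)\<close> are small. It is applied to a window displaced by the sum of
  the small summands.\<close>

lemma regularly_varying_slow_change:
  assumes rv: "regularly_varying f \<rho>" and d: "d > 0"
  shows "\<exists>\<epsilon>>0. \<exists>X. \<forall>x\<ge>X. \<forall>y. \<bar>y - x\<bar> \<le> \<epsilon> * x \<longrightarrow> \<bar>f y - f x\<bar> \<le> d * f x"
proof -
  define d' where "d' = min 1 (d / 4)"
  have d': "d' > 0" "d' \<le> 1" "4 * d' \<le> d" using d by (auto simp: d'_def)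
  obtain X where X: "X > 0" "\<And>x. x \<ge> X \<Longrightarrow> f x > 0"
    "\<And>x y. x \<ge> X \<Longrightarrow> y \<ge> x \<Longrightarrow> \<bar>ln (f y) - ln (f x) - \<rho> * (ln y - ln x)\<bar> \<le> (d'/4) * (1 + ln y - ln x)"
    using regularly_varying_Potter[OF rv, of "d'/4"] d' by auto
  \<comment> \<open>The second entry makes the power part at most \<open>d' / 2\<close>, and
    Potter's term takes the other half of \<open>d'\<close>. The bound 1/2 gives
    \<open>y \<ge> x / 2\<close>, so that for \<open>y < x\<close> the roles can be exchanged at the
    price of \<open>2 * \<epsilon>\<close> in place of \<open>\<epsilon>\<close>.\<close>
  define \<epsilon> where "\<epsilon> = min (1/2) (d' / (4 * (1 + \<bar>\<rho>\<bar>)))"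
  have e: "\<epsilon> > 0" "\<epsilon> \<le> 1/2" using d' by (auto simp: \<epsilon>_def)
  have "\<epsilon> * (4 * (1 + \<bar>\<rho>\<bar>)) \<le> d' / (4 * (1 + \<bar>\<rho>\<bar>)) * (4 * (1 + \<bar>\<rho>\<bar>))"
    by (rule mult_right_mono) (auto simp: \<epsilon>_def)
  also have "\<dots> = d'" by (auto simp: field_simps)
  finally have e3: "\<epsilon> * (4 * (1 + \<bar>\<rho>\<bar>)) \<le> d'" .
  have lnlip: "ln v - ln u \<le> 2 * \<epsilon>" if "u > 0" "v \<ge> u" "v - u \<le> 2 * \<epsilon> * u" for u v
  proof -
    have "ln v - ln u = ln (v / u)" using that by (simp add: ln_div)
    also have "\<dots> \<le> v / u - 1" using that by (intro ln_le_minus_one) auto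
    also have "\<dots> \<le> 2 * \<epsilon>" using that by (simp add: field_simps)
    finally show ?thesis .
  qed
  have key: "\<bar>ln (f v) - ln (f u)\<bar> \<le> d'" if "u \<ge> X" "v \<ge> u" "v - u \<le> 2 * \<epsilon> * u" for u v
  proof -
    have l: "ln v - ln u \<le> 2 * \<epsilon>" "ln v - ln u \<ge> 0" using lnlip[of u v] that X(1) by auto
    have "\<bar>ln (f v) - ln (f u)\<bar> \<le> \<bar>\<rho> * (ln v - ln u)\<bar> + (d'/4) * (1 + ln v - ln u)"
      using X(3)[OF that(1,2)] by linarith
    also have "\<bar>\<rho> * (ln v - ln u)\<bar> \<le> \<bar>\<rho>\<bar> * (2 * \<epsilon>)"
      unfolding abs_mult by (rule mult_left_mono) (use l in auto)
    also have "(d'/4) * (1 + ln v - ln u) \<le> (d'/4) * 2"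
      by (rule mult_left_mono) (use l e d' in auto)
    also have "\<bar>\<rho>\<bar> * (2 * \<epsilon>) + d' / 4 * 2 \<le> d'"
      using e3 e(1) by (simp add: algebra_simps)
    finally show ?thesis by simp
  qed
  have "\<bar>f y - f x\<bar> \<le> d * f x" if x: "2 * X \<le> x" and y: "\<bar>y - x\<bar> \<le> \<epsilon> * x" for x y
  proof -
    have "\<epsilon> * x \<le> (1/2) * x" by (rule mult_right_mono) (use e X x in auto)
    then have y2: "y \<ge> x / 2" using y by linarith
    have pos: "f x > 0" "f y > 0" using X(1) X(2)[of x] X(2)[of y] x y2 by auto
    have "\<bar>ln (f y) - ln (f x)\<bar> \<le> d'"
    proof (cases "y \<ge> x")
      case True
      have "\<epsilon> * x \<ge> 0" using e x X by simp
      then have "y - x \<le> 2 * \<epsilon> * x" using y by linarith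
      then show ?thesis using key[of x y] True x X(1) by simp
    next
      case False
      have "\<epsilon> * (x - 2 * y) \<le> 0" using e y2 by (intro mult_nonneg_nonpos) auto
      then have "x - y \<le> 2 * \<epsilon> * y" using y by (simp add: algebra_simps)
      then show ?thesis using key[of y x] False y2 x by auto
    qed
    then have l: "ln (f y / f x) \<le> d'" "- d' \<le> ln (f y / f x)" using pos by (auto simp: ln_div)
    have "f y / f x = exp (ln (f y / f x))" using pos by simp
    also have "\<dots> \<le> exp d'" using l by simp
    also have "\<dots> \<le> 1 + d' + d'\<^sup>2" using d' by (intro exp_bound) auto
    also have "\<dots> \<le> 1 + 2 * d'" using d' by (simp add: power2_eq_square mult_left_le)
    finally have u: "f y / f x \<le> 1 + d" using d' by linarith
    have "1 + (- d') \<le> exp (- d')" by (rule exp_ge_add_one_self)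
    also have "\<dots> \<le> exp (ln (f y / f x))" using l by simp
    also have "\<dots> = f y / f x" using pos by simp
    finally have "f y / f x \<ge> 1 - d" using d' by linarith
    with u show ?thesis using pos by (simp add: field_simps abs_le_iff)
  qed
  then show ?thesis using e(1) by blast
qed

subsection \<open>Truncated means and exponential moments\<close>

text \<open>An upper bound of Karamata type by doubling. From
  \<open>min Y (2 * z) \<le> min Y z + z * 1{Y > z}\<close> the bound \<open>C * z * g z\<close>
  becomes \<open>(C + 1) * z * g z\<close>, and \<open>grow\<close> turns this into the bound at
  \<open>2 * z\<close> once \<open>C + 1 \<le> C * q\<close>.\<close>

lemma (in prob_space) expectation_min_le:
  fixes Y :: "'a \<Rightarrow> real"
  assumes Y[measurable]: "random_variable borel Y" and Y0: "\<And>\<omega>. Y \<omega> \<ge> 0"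
    and X: "X > 0" and q: "q > 1" and l: "l > 0"
    and tail: "\<And>x. x \<ge> X \<Longrightarrow> prob {\<omega>\<in>space M. Y \<omega> > x} \<le> g x"
    and grow: "\<And>x. x \<ge> X \<Longrightarrow> q * g x \<le> 2 * g (2 * x)"
    and low: "\<And>x. x \<in> {X..2*X} \<Longrightarrow> l \<le> g x"
  shows "\<exists>C>0. \<forall>x\<ge>X. expectation (\<lambda>\<omega>. min (Y \<omega>) x) \<le> C * (x * g x)"
proof -
  \<comment> \<open>\<open>C * (q - 1) \<ge> 1\<close> carries the doubling step;
    \<open>C * l \<ge> 1\<close> makes the trivial bound \<open>x\<close> sufficient on
    \<open>{X..2*X}\<close>.\<close>
  define C where "C = max (1 / (q - 1)) (1 / l)"
  have C: "C > 0" "C * l \<ge> 1" "C * (q - 1) \<ge> 1"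
    using q l by (auto simp: C_def less_max_iff_disj max_mult_distrib_right le_max_iff_disj)
  have int[simp]: "integrable M (\<lambda>\<omega>. min (Y \<omega>) x)" if "x \<ge> 0" for x
    by (rule integrable_const_bound[where B = x]) (use Y0 that in auto)
  have *: "expectation (\<lambda>\<omega>. min (Y \<omega>) x) \<le> C * (x * g x)" if "x \<ge> X" "x \<le> 2 ^ n * X" for x and n :: nat
    using that
  proof (induction n arbitrary: x)
    case 0
    then have x: "x = X" by simp
    have "expectation (\<lambda>\<omega>. min (Y \<omega>) x) \<le> expectation (\<lambda>\<omega>. x)"
      by (rule integral_mono) (use x X in auto)
    also have "\<dots> \<le> (C * l) * x" using C(2) x X by (simp add: prob_space)
    also have "\<dots> \<le> C * (x * g x)" using low[of x] x X C(1) by simp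
    finally show ?case .
  next
    case (Suc n)
    show ?case
    proof (cases "x \<le> 2 * X")
      case True
      have "expectation (\<lambda>\<omega>. min (Y \<omega>) x) \<le> expectation (\<lambda>\<omega>. x)"
        by (rule integral_mono) (use Suc.prems X in auto)
      also have "\<dots> \<le> (C * l) * x" using C(2) Suc.prems X by (simp add: prob_space)
      also have "\<dots> \<le> C * (x * g x)" using low[of x] Suc.prems True X C(1) by simp
      finally show ?thesis .
    next
      case False
      define z where "z = x / 2"
      have z: "z \<ge> X" "z > 0" "x = 2 * z" "z \<le> 2 ^ n * X" using False Suc.prems X by (auto simp: z_def)
      have gz: "g z \<ge> 0" using tail[OF z(1)] measure_nonneg order_trans by blast
      have "expectation (\<lambda>\<omega>. min (Y \<omega>) x)
          \<le> expectation (\<lambda>\<omega>. min (Y \<omega>) z + z * indicator {\<omega>\<in>space M. Y \<omega> > z} \<omega>)"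
      proof (rule integral_mono)
        show "integrable M (\<lambda>\<omega>. min (Y \<omega>) z + z * indicator {\<omega>\<in>space M. Y \<omega> > z} \<omega>)"
          using z by (auto simp: less_top[symmetric])
      qed (use z in \<open>auto simp: indicator_def\<close>)
      also have "\<dots> = expectation (\<lambda>\<omega>. min (Y \<omega>) z) + z * prob {\<omega>\<in>space M. Y \<omega> > z}"
        by (subst Bochner_Integration.integral_add) (use z in \<open>auto simp: less_top[symmetric]\<close>)
      also have "\<dots> \<le> C * (z * g z) + z * g z"
        by (intro add_mono Suc.IH mult_left_mono tail) (use z in auto)
      also have "\<dots> = (C + 1) * (z * g z)" by (simp add: algebra_simps)
      also have "\<dots> \<le> (C * q) * (z * g z)"
        using C(3) z gz by (intro mult_right_mono) (auto simp: algebra_simps)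
      also have "\<dots> = (C * z) * (q * g z)" by simp
      also have "\<dots> \<le> (C * z) * (2 * g (2 * z))"
        by (intro mult_left_mono grow) (use z C in auto)
      also have "\<dots> = C * (x * g x)" by (simp add: z(3))
      finally show ?thesis .
    qed
  qed
  have "expectation (\<lambda>\<omega>. min (Y \<omega>) x) \<le> C * (x * g x)" if "x \<ge> X" for x
  proof -
    obtain n where "x / X < 2 ^ n" using real_arch_pow[of 2 "x/X"] by auto
    then show ?thesis using *[of x n] that X by (simp add: field_simps)
  qed
  then show ?thesis using C(1) by blast
qed

text \<open>The ratio 2 f(2x) / f(x) tends to 2 to the power 1 - \<alpha>, which exceeds 1 because
  \<alpha> < 1; hence the truncated mean is dominated by its last dyadic scale.\<close>

lemma (in prob_space) truncated_mean_regularly_varying: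
  fixes Y :: "'a \<Rightarrow> real"
  assumes Y: "random_variable borel Y" and Y0: "\<And>\<omega>. Y \<omega> \<ge> 0"
    and rv: "regularly_varying f (- \<alpha>)" and a: "\<alpha> < 1" and f: "antimono f"
    and tail: "\<forall>\<^sub>F x in at_top. prob {\<omega>\<in>space M. Y \<omega> > x} \<le> c * f x"
  shows "\<exists>C>0. \<forall>\<^sub>F x in at_top. expectation (\<lambda>\<omega>. min (Y \<omega>) x) \<le> C * (x * f x)"
proof -
  \<comment> \<open>The geometric mean of 1 and the limit of 2 f(2x) / f(x), hence strictly between
    them.\<close>
  define q :: real where "q = 2 powr ((1 - \<alpha>) / 2)"
  have q: "q > 1" "q < 2 powr (1 - \<alpha>)" using a by (auto simp: q_def)
  have "((\<lambda>x. f (2 * x) / f x) \<longlongrightarrow> 2 powr (- \<alpha>)) at_top"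
    using rv by (auto simp: regularly_varying_def)
  then have lim: "((\<lambda>x. 2 * (f (2 * x) / f x)) \<longlongrightarrow> 2 * 2 powr (- \<alpha>)) at_top"
    by (intro tendsto_intros)
  have "2 * 2 powr (- \<alpha>) = (2::real) powr (1 - \<alpha>)" by (simp add: powr_diff powr_minus field_simps)
  with lim q have "\<forall>\<^sub>F x in at_top. q < 2 * (f (2 * x) / f x)"
    by (metis order_tendstoD(1))
  with tail regularly_varying_eventually_pos[OF rv] eventually_gt_at_top[of 0]
  have "\<forall>\<^sub>F x in at_top. q < 2 * (f (2 * x) / f x) \<and> prob {\<omega>\<in>space M. Y \<omega> > x} \<le> c * f x \<and> f x > 0 \<and> x > 0"
    by eventually_elim auto
  then obtain X where X: "\<And>x. x \<ge> X \<Longrightarrow> q < 2 * (f (2 * x) / f x)"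
    "\<And>x. x \<ge> X \<Longrightarrow> prob {\<omega>\<in>space M. Y \<omega> > x} \<le> c * f x"
    "\<And>x. x \<ge> X \<Longrightarrow> f x > 0" "\<And>x. x \<ge> X \<Longrightarrow> x > 0"
    unfolding eventually_at_top_linorder by blast
  define c' where "c' = max c 1"
  have c': "c' > 0" "c \<le> c'" by (auto simp: c'_def)
  have "\<exists>C>0. \<forall>x\<ge>X. expectation (\<lambda>\<omega>. min (Y \<omega>) x) \<le> C * (x * (c' * f x))"
  proof (rule expectation_min_le[OF Y Y0 _ q(1), where l = "c' * f (2 * X)"])
    show "0 < X" using X by auto
    then show "0 < c' * f (2 * X)" using X(3) c' by auto
    show "prob {\<omega> \<in> space M. x < Y \<omega>} \<le> c' * f x" if "X \<le> x" for x
    proof -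
      have "c * f x \<le> c' * f x" by (rule mult_right_mono) (use c' X(3)[OF that] in auto)
      then show ?thesis using X(2)[OF that] by linarith
    qed
    show "q * (c' * f x) \<le> 2 * (c' * f (2 * x))" if "X \<le> x" for x
      using X(1)[OF that] X(3)[OF that] c' by (simp add: field_simps)
    show "c' * f (2 * X) \<le> c' * f x" if "x \<in> {X..2 * X}" for x
      using that f c' by (auto simp: antimono_def)
  qed
  then obtain C where C: "C > 0" "\<And>x. x \<ge> X \<Longrightarrow> expectation (\<lambda>\<omega>. min (Y \<omega>) x) \<le> C * (x * (c' * f x))"
    by blast
  have "expectation (\<lambda>\<omega>. min (Y \<omega>) x) \<le> C * c' * (x * f x)" if "x \<ge> X" for x
    using C(2)[OF that] by (simp add: mult_ac)
  moreover have "C * c' > 0" using C(1) c'(1) by simp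
  ultimately show ?thesis unfolding eventually_at_top_linorder by blast
qed

section \<open>Markov and Chernoff bounds for sums of truncated variables\<close>

text \<open>Markov's inequality is applied after truncation at \<open>x\<close>, as the variables
  need not be integrable. Truncation loses nothing on the event: if some \<open>Y i\<close> exceeds
  \<open>x\<close>, the truncated sum is already at least \<open>x \<ge> \<epsilon> * x\<close>, and
  otherwise no term changes.\<close>

lemma (in prob_space) sum_tail_le_truncated_mean:
  fixes Y :: "'i \<Rightarrow> 'a \<Rightarrow> real"
  assumes fin: "finite I" and Y[measurable]: "\<And>i. i \<in> I \<Longrightarrow> random_variable borel (Y i)"
    and Y0: "\<And>i \<omega>. Y i \<omega> \<ge> 0"
    and m: "\<And>i. i \<in> I \<Longrightarrow> expectation (\<lambda>\<omega>. min (Y i \<omega>) x) \<le> m"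
    and e: "0 < \<epsilon>" "\<epsilon> \<le> 1" and x: "x > 0"
  shows "prob {\<omega>\<in>space M. (\<Sum>i\<in>I. Y i \<omega>) > \<epsilon> * x} \<le> real (card I) * m / (\<epsilon> * x)"
proof -
  have int: "integrable M (\<lambda>\<omega>. min (Y i \<omega>) x)" if "i \<in> I" for i
    by (rule integrable_const_bound[where B = x]) (use Y0 that x in auto)
  have "prob {\<omega>\<in>space M. (\<Sum>i\<in>I. Y i \<omega>) > \<epsilon> * x} \<le> prob {\<omega>\<in>space M. (\<Sum>i\<in>I. min (Y i \<omega>) x) \<ge> \<epsilon> * x}"
  proof (rule finite_measure_mono)
    show "{\<omega>\<in>space M. (\<Sum>i\<in>I. Y i \<omega>) > \<epsilon> * x} \<subseteq> {\<omega>\<in>space M. (\<Sum>i\<in>I. min (Y i \<omega>) x) \<ge> \<epsilon> * x}"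
    proof safe
      fix \<omega> assume gt: "(\<Sum>i\<in>I. Y i \<omega>) > \<epsilon> * x"
      show "(\<Sum>i\<in>I. min (Y i \<omega>) x) \<ge> \<epsilon> * x"
      proof (cases "\<exists>i\<in>I. Y i \<omega> > x")
        case True
        then obtain i where i: "i \<in> I" "Y i \<omega> > x" by blast
        have "\<epsilon> * x \<le> 1 * x" using e x by (intro mult_right_mono) auto
        also have "\<dots> = min (Y i \<omega>) x" using i by simp
        also have "\<dots> \<le> (\<Sum>i\<in>I. min (Y i \<omega>) x)"
          by (rule member_le_sum) (use i fin Y0 x in auto)
        finally show ?thesis .
      next
        case False
        then have "(\<Sum>i\<in>I. min (Y i \<omega>) x) = (\<Sum>i\<in>I. Y i \<omega>)"
          by (intro sum.cong) auto
        then show ?thesis using gt by simp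
      qed
    qed
  qed measurable
  also have "\<dots> \<le> expectation (\<lambda>\<omega>. \<Sum>i\<in>I. min (Y i \<omega>) x) / (\<epsilon> * x)"
    by (rule integral_Markov_inequality_measure[where A = "{}"])
      (use e x Y0 int in \<open>auto intro!: sum_nonneg Bochner_Integration.integrable_sum\<close>)
  also have "expectation (\<lambda>\<omega>. \<Sum>i\<in>I. min (Y i \<omega>) x) = (\<Sum>i\<in>I. expectation (\<lambda>\<omega>. min (Y i \<omega>) x))"
    by (rule Bochner_Integration.integral_sum) (use int in auto)
  also have "\<dots> \<le> (\<Sum>i\<in>I. m)" by (rule sum_mono) (use m in auto)
  finally show ?thesis using e x by (simp add: divide_right_mono)
qed

text \<open>On the event no factor is cut off, so the product of the truncated exponentials
  \<open>h (Z i)\<close> equals the exponential of \<open>s\<close> times the sum. As each factor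
  has mean at most 1, the bound does not depend on the number of summands.\<close>

lemma (in prob_space) Chernoff_truncated_sum:
  fixes Z :: "'i \<Rightarrow> 'a \<Rightarrow> real"
  assumes ind: "indep_vars (\<lambda>_. borel) Z I" and fin: "finite I" and s: "s \<ge> 0"
    and mgf: "\<And>i. i \<in> I \<Longrightarrow> expectation (\<lambda>\<omega>. exp (s * Z i \<omega>) * indicator {..b} (Z i \<omega>)) \<le> 1"
  shows "prob {\<omega>\<in>space M. (\<Sum>i\<in>I. Z i \<omega>) > x \<and> (\<forall>i\<in>I. Z i \<omega> \<le> b)} \<le> exp (- s * x)"
proof -
  define h where "h z = exp (s * z) * indicator {..b} z" for z :: real
  have hm[measurable]: "h \<in> borel_measurable borel" unfolding h_def by measurable
  have h0: "h z \<ge> 0" for z by (auto simp: h_def)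
  have hb: "h z \<le> exp (s * b)" for z
    using s by (auto simp: h_def indicator_def mult_left_mono)
  have rv[measurable]: "random_variable borel (Z i)" if "i \<in> I" for i
    using ind that by (auto simp: indep_vars_def)
  have ind': "indep_vars (\<lambda>_. borel) (\<lambda>i \<omega>. h (Z i \<omega>)) I"
    by (rule indep_vars_compose2[OF ind]) auto
  have int: "integrable M (\<lambda>\<omega>. h (Z i \<omega>))" if "i \<in> I" for i
    by (rule integrable_const_bound[where B = "exp (s * b)"]) (use h0 hb that in auto)
  have intP: "integrable M (\<lambda>\<omega>. \<Prod>i\<in>I. h (Z i \<omega>))"
    by (rule indep_vars_integrable[OF fin ind' int])
  have "prob {\<omega>\<in>space M. (\<Sum>i\<in>I. Z i \<omega>) > x \<and> (\<forall>i\<in>I. Z i \<omega> \<le> b)}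
      \<le> prob {\<omega>\<in>space M. (\<Prod>i\<in>I. h (Z i \<omega>)) \<ge> exp (s * x)}"
  proof (rule finite_measure_mono)
    show "{\<omega>\<in>space M. (\<Sum>i\<in>I. Z i \<omega>) > x \<and> (\<forall>i\<in>I. Z i \<omega> \<le> b)}
      \<subseteq> {\<omega>\<in>space M. (\<Prod>i\<in>I. h (Z i \<omega>)) \<ge> exp (s * x)}"
    proof safe
      fix \<omega> assume *: "(\<Sum>i\<in>I. Z i \<omega>) > x" "\<forall>i\<in>I. Z i \<omega> \<le> b"
      have "(\<Prod>i\<in>I. h (Z i \<omega>)) = (\<Prod>i\<in>I. exp (s * Z i \<omega>))"
        by (rule prod.cong) (use * in \<open>auto simp: h_def\<close>)
      also have "\<dots> = exp (s * (\<Sum>i\<in>I. Z i \<omega>))"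
        using fin by (simp add: exp_sum sum_distrib_left)
      also have "\<dots> \<ge> exp (s * x)" using * s by (simp add: mult_left_mono)
      finally show "(\<Prod>i\<in>I. h (Z i \<omega>)) \<ge> exp (s * x)" .
    qed
  qed measurable
  also have "\<dots> \<le> expectation (\<lambda>\<omega>. \<Prod>i\<in>I. h (Z i \<omega>)) / exp (s * x)"
    by (rule integral_Markov_inequality_measure[where A = "{}"])
      (use h0 intP in \<open>auto intro!: prod_nonneg\<close>)
  also have "expectation (\<lambda>\<omega>. \<Prod>i\<in>I. h (Z i \<omega>)) = (\<Prod>i\<in>I. expectation (\<lambda>\<omega>. h (Z i \<omega>)))"
    by (rule indep_vars_lebesgue_integral[OF fin ind' int])
  also have "\<dots> \<le> 1"
    by (rule prod_le_1) (use mgf h0 in \<open>auto simp: h_def\<close>)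
  finally show ?thesis by (simp add: exp_minus field_simps divide_right_mono)
qed

text \<open>The heavier left tail pays for the truncated right tail: with \<open>t = 1 / \<lambda>\<close>, the
  negative jumps lower the moment generating function by the order of \<open>P(\<xi> \<le> - t)\<close>, whereas
  jumps in \<open>(0, \<eta> * x]\<close> raise it by at most the order of \<open>x powr (K * \<eta>) * t powr (- \<gamma>)\<close>
  for any \<open>\<gamma> < min 1 \<beta>\<close>.\<close>

lemma (in prob_space) truncated_mgf_le_1:
  fixes Z :: "'a \<Rightarrow> real"
  assumes Z[measurable]: "random_variable borel Z"
    and left: "regularly_varying (\<lambda>y. prob {\<omega>\<in>space M. Z \<omega> \<le> - y}) (- \<alpha>)"
    and right: "regularly_varying (\<lambda>y. prob {\<omega>\<in>space M. Z \<omega> > y}) (- \<beta>)"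
    and a: "0 < \<alpha>" "\<alpha> < 1" and b: "\<alpha> < \<beta>" and K: "K > 0"
  shows "\<exists>\<eta>>0. \<forall>\<^sub>F x in at_top.
    expectation (\<lambda>\<omega>. exp (K * ln x / x * Z \<omega>) * indicator {..\<eta> * x} (Z \<omega>)) \<le> 1"
proof -
  define b' where "b' = min 1 \<beta>"
  have b': "\<alpha> < b'" "b' \<le> 1" "b' \<le> \<beta>" using a b by (auto simp: b'_def)
  \<comment> \<open>The exponents are spaced as \<alpha> < \<gamma>' < \<gamma> < b' with steps of
    \<open>4 * d\<close>: \<gamma>' serves the lower bound for the left tail, \<gamma> < \<beta> the
    upper bound for the right tail, and \<gamma> < 1 the truncated mean.\<close>
  define d where "d = (b' - \<alpha>) / 12"
  define \<gamma> where "\<gamma> = \<alpha> + 8 * d"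
  define \<gamma>' where "\<gamma>' = \<alpha> + 4 * d"
  have d: "d > 0" using b' by (simp add: d_def)
  have b'd: "b' = \<alpha> + 12 * d" unfolding d_def by (simp add: field_simps)
  have \<gamma>: "0 < \<gamma>" "\<gamma> < 1" "\<gamma> < \<beta>" "\<alpha> < \<gamma>'" "\<gamma> = \<gamma>' + 4 * d"
    using a b' b'd d by (auto simp: \<gamma>_def \<gamma>'_def)
  define \<eta> where "\<eta> = d / K"
  have \<eta>: "\<eta> > 0" using d K by (simp add: \<eta>_def)
  have evL: "\<forall>\<^sub>F t in at_top. prob {\<omega>\<in>space M. Z \<omega> \<le> - t} \<ge> t powr (- \<gamma>')"
    by (rule regularly_varying_eventually_ge_powr[OF left]) (use \<gamma> in auto)
  have evR: "\<forall>\<^sub>F t in at_top. prob {\<omega>\<in>space M. Z \<omega> > t} \<le> t powr (- \<gamma>)"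
    by (rule regularly_varying_eventually_le_powr[OF right]) (use \<gamma> in auto)
  obtain X0 where X0: "\<And>t. t \<ge> X0 \<Longrightarrow> prob {\<omega>\<in>space M. Z \<omega> > t} \<le> t powr (- \<gamma>)"
    using evR by (auto simp: eventually_at_top_linorder)
  define X where "X = max X0 1"
  have X: "X > 0" "X \<ge> X0" by (auto simp: X_def)
  have "\<exists>C>0. \<forall>x\<ge>X. expectation (\<lambda>\<omega>. min (max (Z \<omega>) 0) x) \<le> C * (x * (x powr (- \<gamma>)))"
  proof (rule expectation_min_le[where l = "(2 * X) powr (- \<gamma>)" and q = "2 powr (1 - \<gamma>)"])
    show "prob {\<omega> \<in> space M. x < max (Z \<omega>) 0} \<le> x powr - \<gamma>" if "X \<le> x" for x
    proof -
      have "{\<omega> \<in> space M. x < max (Z \<omega>) 0} = {\<omega> \<in> space M. x < Z \<omega>}" using that X by auto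
      then show ?thesis using X0[of x] that X by simp
    qed
    show "2 powr (1 - \<gamma>) * x powr - \<gamma> \<le> 2 * (2 * x) powr - \<gamma>" if "X \<le> x" for x
      using that X by (simp add: powr_mult powr_diff powr_minus field_simps)
    show "(2 * X) powr - \<gamma> \<le> x powr - \<gamma>" if "x \<in> {X..2 * X}" for x
      using that X \<gamma> by (intro powr_mono2') auto
  qed (use X \<gamma> in auto)
  then obtain C where C: "C > 0" "\<And>x. x \<ge> X \<Longrightarrow> expectation (\<lambda>\<omega>. min (max (Z \<omega>) 0) x) \<le> C * (x * (x powr (- \<gamma>)))"
    by blast
  have tlim: "filterlim (\<lambda>x. x / (K * ln x)) at_top at_top"
    using K by real_asymp
  \<comment> \<open>As \<open>t\<close> is at least the square root of \<open>x\<close>, the gap of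
    \<open>4 * d\<close> between \<gamma>' and \<gamma> gains a factor
    \<open>x powr (- 2 * d)\<close>, which beats the loss \<open>x powr d\<close>.\<close>
  have ev1: "\<forall>\<^sub>F x in at_top. x powr (1/2) \<le> x / (K * ln x)"
    using K by real_asymp
  have "((\<lambda>x. (2 * C + x powr d) * x powr (- 2 * d)) \<longlongrightarrow> 0) at_top"
    using d by real_asymp
  then have ev2: "\<forall>\<^sub>F x in at_top. (2 * C + x powr d) * x powr (- 2 * d) < 1 / 2"
    by (rule order_tendstoD) simp
  have "\<forall>\<^sub>F t in at_top. prob {\<omega>\<in>space M. Z \<omega> \<le> - t} \<ge> t powr (- \<gamma>') \<and> t \<ge> X"
    using evL eventually_ge_at_top[of X] by eventually_elim auto
  then have ev3: "\<forall>\<^sub>F x in at_top. prob {\<omega>\<in>space M. Z \<omega> \<le> - (x / (K * ln x))} \<ge> (x / (K * ln x)) powr (- \<gamma>')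
      \<and> x / (K * ln x) \<ge> X"
    using tlim by (rule eventually_compose_filterlim)
  have "\<forall>\<^sub>F x in at_top.
    expectation (\<lambda>\<omega>. exp (K * ln x / x * Z \<omega>) * indicator {..\<eta> * x} (Z \<omega>)) \<le> 1"
    using ev1 ev2 ev3 eventually_gt_at_top[of 1]
  proof eventually_elim
    case (elim x)
    define t where "t = x / (K * ln x)"
    have t: "t \<ge> X" "t > 0" "x powr (1/2) \<le> t" "prob {\<omega>\<in>space M. Z \<omega> \<le> - t} \<ge> t powr (- \<gamma>')"
      using elim X by (auto simp: t_def)
    have lt: "K * ln x / x * z = z / t" for z by (simp add: t_def)
    have "\<eta> * x / t = d * ln x" using elim K by (simp add: t_def \<eta>_def)
    then have ex: "exp (\<eta> * x / t) = x powr d" using elim by (simp add: powr_def)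
    let ?L = "{\<omega>\<in>space M. Z \<omega> \<le> - t}" and ?R = "{\<omega>\<in>space M. Z \<omega> > t}"
    have ip: "integrable M (\<lambda>\<omega>. min (max (Z \<omega>) 0) t)"
      by (rule integrable_const_bound[where B = t]) (use t in auto)
    have ie: "integrable M (\<lambda>\<omega>. exp (Z \<omega> / t) * indicator {..\<eta> * x} (Z \<omega>))"
      by (rule integrable_const_bound[where B = "exp (\<eta> * x / t)"])
        (use t in \<open>auto simp: indicator_def divide_right_mono\<close>)
    have e1: "exp (-1) \<le> (1/2::real)"
      using exp_ge_add_one_self[of "1::real"] by (simp add: exp_minus field_simps)
    have "expectation (\<lambda>\<omega>. exp (Z \<omega> / t) * indicator {..\<eta> * x} (Z \<omega>))
        \<le> expectation (\<lambda>\<omega>. 1 - 1/2 * indicator ?L \<omega> + 2 / t * min (max (Z \<omega>) 0) t + x powr d * indicator ?R \<omega>)"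
    proof (rule integral_mono[OF ie])
      fix \<omega> assume w: "\<omega> \<in> space M"
      \<comment> \<open>The exponential is at most exp (-1) \<le> 1/2 on the first range, at most 1
        on the second, at most \<open>1 + 2 * Z / t\<close> on the third, and capped by
        \<open>x powr d\<close> on the last by the truncation.\<close>
      consider "Z \<omega> \<le> - t" | "- t < Z \<omega>" "Z \<omega> \<le> 0" | "0 < Z \<omega>" "Z \<omega> \<le> t" | "Z \<omega> > t" by linarith
      then show "exp (Z \<omega> / t) * indicator {..\<eta> * x} (Z \<omega>)
         \<le> 1 - 1/2 * indicator ?L \<omega> + 2 / t * min (max (Z \<omega>) 0) t + x powr d * indicator ?R \<omega>"
      proof cases
        case 1
        have "Z \<omega> / t \<le> - 1" using 1 t by (simp add: field_simps)
        then have "exp (Z \<omega> / t) \<le> exp (- 1)" by simp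
        then have "exp (Z \<omega> / t) \<le> 1/2" using e1 by linarith
        moreover have "exp (Z \<omega> / t) * indicator {..\<eta> * x} (Z \<omega>) \<le> exp (Z \<omega> / t)"
          by (auto simp: indicator_def)
        ultimately show ?thesis using 1 t w by (simp add: indicator_def)
      next
        case 2
        have "exp (Z \<omega> / t) \<le> 1" using 2 t by (simp add: field_simps)
        then show ?thesis using 2 t w by (auto simp: indicator_def)
      next
        case 3
        define u where "u = Z \<omega> / t"
        have u: "0 \<le> u" "u \<le> 1" using 3 t by (auto simp: u_def)
        have "exp u \<le> 1 + u + u\<^sup>2" using u by (intro exp_bound) auto
        also have "\<dots> \<le> 1 + 2 * u" using u by (simp add: power2_eq_square mult_left_le)
        finally show ?thesis using 3 t w u by (auto simp: indicator_def u_def)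
      next
        case 4
        have "exp (Z \<omega> / t) * indicator {..\<eta> * x} (Z \<omega>) \<le> exp (\<eta> * x / t)"
          using t by (auto simp: indicator_def divide_right_mono)
        then show ?thesis using 4 t w ex by (auto simp: indicator_def)
      qed
    qed (use ip in \<open>auto simp: less_top[symmetric]\<close>)
    also have "\<dots> = 1 - 1/2 * prob ?L + 2 / t * expectation (\<lambda>\<omega>. min (max (Z \<omega>) 0) t) + x powr d * prob ?R"
      using ip by (simp add: less_top[symmetric] prob_space)
    also have "\<dots> \<le> 1 - 1/2 * t powr (- \<gamma>') + 2 / t * (C * (t * t powr (- \<gamma>))) + x powr d * t powr (- \<gamma>)"
      using t X C(2)[of t] X0[of t]
      by (intro add_mono diff_mono mult_left_mono) auto
    also have "\<dots> = 1 - 1/2 * t powr (- \<gamma>') + (2 * C + x powr d) * t powr (- \<gamma>)"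
      using t by (simp add: algebra_simps)
    also have "\<dots> \<le> 1"
    proof -
      have "t powr (- 4 * d) \<le> (x powr (1/2)) powr (- 4 * d)"
        using t d elim by (intro powr_mono2') auto
      also have "\<dots> = x powr (- 2 * d)" by (simp add: powr_powr)
      finally have s: "t powr (- 4 * d) \<le> x powr (- 2 * d)" .
      have "(2 * C + x powr d) * t powr (- \<gamma>) = t powr (- \<gamma>') * ((2 * C + x powr d) * t powr (- 4 * d))"
        unfolding \<gamma>(5) by (simp add: powr_add[symmetric])
      also have "\<dots> \<le> t powr (- \<gamma>') * ((2 * C + x powr d) * x powr (- 2 * d))"
        using s C(1) by (intro mult_left_mono) auto
      also have "\<dots> \<le> t powr (- \<gamma>') * (1/2)"
        using elim by (intro mult_left_mono) auto
      finally show ?thesis by simp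
    qed
    finally show ?case unfolding lt .
  qed
  then show ?thesis using \<eta> by blast
qed

subsection \<open>The one-big-jump decomposition\<close>

text \<open>Fubini for the product law of \<open>(X, Y)\<close>: an estimate for every frozen value
  \<open>y\<close> integrates to one for the pair. The factor \<open>indicator B y\<close> keeps the
  cost of the event that \<open>Y\<close> lies in \<open>B\<close>.\<close>

lemma (in prob_space) indep_var_section_bounds:
  assumes ind: "indep_var S X N Y" and E: "E \<in> sets (S \<Otimes>\<^sub>M N)" and B: "B \<in> sets N"
  shows "(\<And>y. y \<in> space N \<Longrightarrow> prob {\<omega>\<in>space M. (X \<omega>, y) \<in> E} \<le> c * indicator B y) \<Longrightarrow>
      prob {\<omega>\<in>space M. (X \<omega>, Y \<omega>) \<in> E} \<le> c * prob {\<omega>\<in>space M. Y \<omega> \<in> B}"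
    and "(\<And>y. y \<in> space N \<Longrightarrow> c * indicator B y \<le> prob {\<omega>\<in>space M. (X \<omega>, y) \<in> E}) \<Longrightarrow>
      c * prob {\<omega>\<in>space M. Y \<omega> \<in> B} \<le> prob {\<omega>\<in>space M. (X \<omega>, Y \<omega>) \<in> E}"
proof -
  have X[measurable]: "random_variable S X" and Y[measurable]: "random_variable N Y"
    and eq: "distr M S X \<Otimes>\<^sub>M distr M N Y = distr M (S \<Otimes>\<^sub>M N) (\<lambda>x. (X x, Y x))"
    using ind by (auto simp: indep_var_distribution_eq)
  note [measurable] = E B
  interpret DX: prob_space "distr M S X" by (rule prob_space_distr) simp
  interpret DY: prob_space "distr M N Y" by (rule prob_space_distr) simp
  interpret P: pair_prob_space "distr M S X" "distr M N Y" ..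
  have E': "E \<in> sets (distr M S X \<Otimes>\<^sub>M distr M N Y)"
    using E by (simp cong: sets_pair_measure_cong)
  have sec: "measure (distr M S X) ((\<lambda>x. (x, y)) -` E) = prob {\<omega>\<in>space M. (X \<omega>, y) \<in> E}"
    if "y \<in> space N" for y
  proof -
    have "(\<lambda>x. (x, y)) -` E \<in> sets S"
      using sets_Pair2[OF E] .
    then show ?thesis by (subst measure_distr) (auto intro!: arg_cong[where f = prob])
  qed
  have int: "integrable (distr M N Y) (\<lambda>y. measure (distr M S X) ((\<lambda>x. (x, y)) -` E))"
  proof (rule DY.integrable_const_bound[where B = 1])
    show "(\<lambda>y. measure (distr M S X) ((\<lambda>x. (x, y)) -` E)) \<in> borel_measurable (distr M N Y)"
      unfolding measure_def using P.measurable_emeasure_Pair2[OF E'] by simp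
  qed simp
  have "prob {\<omega>\<in>space M. (X \<omega>, Y \<omega>) \<in> E} = measure (distr M (S \<Otimes>\<^sub>M N) (\<lambda>x. (X x, Y x))) E"
    by (subst measure_distr) (auto intro!: arg_cong[where f = prob])
  also have "\<dots> = measure (distr M S X \<Otimes>\<^sub>M distr M N Y) E" by (simp add: eq)
  also have "\<dots> = (\<integral>y. measure (distr M S X) ((\<lambda>x. (x, y)) -` E) \<partial>distr M N Y)"
  proof -
    have "ennreal (measure (distr M S X \<Otimes>\<^sub>M distr M N Y) E)
        = (\<integral>\<^sup>+y. ennreal (measure (distr M S X) ((\<lambda>x. (x, y)) -` E)) \<partial>distr M N Y)"
      using P.emeasure_pair_measure_alt2[OF E']
      by (simp add: P.emeasure_eq_measure DX.emeasure_eq_measure)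
    also have "\<dots> = ennreal (\<integral>y. measure (distr M S X) ((\<lambda>x. (x, y)) -` E) \<partial>distr M N Y)"
      by (rule nn_integral_eq_integral[OF int]) auto
    finally show ?thesis by (subst (asm) ennreal_inj) (auto intro!: integral_nonneg)
  qed
  finally have main: "prob {\<omega>\<in>space M. (X \<omega>, Y \<omega>) \<in> E}
      = (\<integral>y. measure (distr M S X) ((\<lambda>x. (x, y)) -` E) \<partial>distr M N Y)" .
  have rhs: "(\<integral>y. c * indicator B y \<partial>distr M N Y) = c * prob {\<omega>\<in>space M. Y \<omega> \<in> B}"
    using sets.sets_into_space[OF B]
    by (auto simp: measure_distr intro!: arg_cong[where f = prob])
  have intB: "integrable (distr M N Y) (\<lambda>y. c * indicator B y)"
    by (simp add: less_top[symmetric])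
  show "prob {\<omega>\<in>space M. (X \<omega>, Y \<omega>) \<in> E} \<le> c * prob {\<omega>\<in>space M. Y \<omega> \<in> B}"
    if "\<And>y. y \<in> space N \<Longrightarrow> prob {\<omega>\<in>space M. (X \<omega>, y) \<in> E} \<le> c * indicator B y"
    unfolding main rhs[symmetric]
    by (rule integral_mono[OF int intB]) (use that sec in auto)
  show "c * prob {\<omega>\<in>space M. Y \<omega> \<in> B} \<le> prob {\<omega>\<in>space M. (X \<omega>, Y \<omega>) \<in> E}"
    if "\<And>y. y \<in> space N \<Longrightarrow> c * indicator B y \<le> prob {\<omega>\<in>space M. (X \<omega>, y) \<in> E}"
    unfolding main rhs[symmetric]
    by (rule integral_mono[OF intB int]) (use that sec in auto)
qed

text \<open>Besides the sum of the other summands, the sum of their absolute values is kept: a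
  summand exceeding half the total while the others are absolutely summable to at most
  \<open>\<epsilon> * x\<close> is unique, so that the one-big-jump events are disjoint. The padding by \<open>0\<close> is due to
  \<open>indep_var\<close>, which relates random variables with values in a single type.\<close>

lemma (in prob_space) indep_var_others:
  fixes Z :: "'i \<Rightarrow> 'a \<Rightarrow> real"
  assumes ind: "indep_vars (\<lambda>_. borel) Z I" and fin: "finite I" and i: "i \<in> I"
  shows "indep_var borel (\<lambda>\<omega>. (Z i \<omega>, 0 :: real)) borel (\<lambda>\<omega>. (\<Sum>j\<in>I-{i}. Z j \<omega>, \<Sum>j\<in>I-{i}. \<bar>Z j \<omega>\<bar>))"
proof -
  have "indep_var (PiM {i} (\<lambda>_. borel)) (\<lambda>\<omega>. restrict (\<lambda>j. Z j \<omega>) {i})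
      (PiM (I - {i}) (\<lambda>_. borel)) (\<lambda>\<omega>. restrict (\<lambda>j. Z j \<omega>) (I - {i}))"
    by (rule indep_var_restrict[OF ind]) (use i in auto)
  then have "indep_var borel ((\<lambda>g. (g i, 0 :: real)) \<circ> (\<lambda>\<omega>. restrict (\<lambda>j. Z j \<omega>) {i}))
      borel ((\<lambda>g. (\<Sum>j\<in>I-{i}. g j, \<Sum>j\<in>I-{i}. \<bar>g j\<bar>)) \<circ> (\<lambda>\<omega>. restrict (\<lambda>j. Z j \<omega>) (I - {i})))"
    by (rule indep_var_compose) measurable
  then show ?thesis by (simp add: comp_def)
qed

text \<open>Here \<phi> stands for the window probability of one summand, \<open>r\<close> bounds
  the probability that the others are not small, and \<kappa> covers the case without a summand
  above \<open>b\<close>. The lower bound uses only the disjoint events \<open>A i\<close>; the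
  upper one adds union bounds for the events \<open>A' i\<close> and \<open>A0\<close>.\<close>

lemma (in prob_space) big_jump_bounds:
  fixes Z :: "'i \<Rightarrow> 'a \<Rightarrow> real"
  assumes ind: "indep_vars (\<lambda>_. borel) Z I" and fin: "finite I"
    and S[measurable]: "S \<in> sets borel" and Sx: "S \<subseteq> {x<..}"
    and x: "x > 0" and e: "0 < \<epsilon>" "\<epsilon> \<le> 1/2" and \<phi>: "\<phi> \<ge> 0" and d: "0 \<le> d" "d \<le> 1" and C: "C \<ge> 0"
    and near: "\<And>i s. i \<in> I \<Longrightarrow> \<bar>s\<bar> \<le> \<epsilon> * x \<Longrightarrow> \<bar>prob {\<omega>\<in>space M. Z i \<omega> + s \<in> S} - \<phi>\<bar> \<le> d * \<phi>"
    and far: "\<And>i s. i \<in> I \<Longrightarrow> prob {\<omega>\<in>space M. Z i \<omega> + s \<in> S \<and> Z i \<omega> > b} \<le> C * \<phi>"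
    and small: "\<And>i. i \<in> I \<Longrightarrow> prob {\<omega>\<in>space M. (\<Sum>j\<in>I-{i}. \<bar>Z j \<omega>\<bar>) > \<epsilon> * x} \<le> r"
    and none: "prob {\<omega>\<in>space M. (\<Sum>i\<in>I. Z i \<omega>) > x \<and> (\<forall>i\<in>I. Z i \<omega> \<le> b)} \<le> \<kappa>"
  shows "real (card I) * ((1 - d) * \<phi> * (1 - r)) \<le> prob {\<omega>\<in>space M. (\<Sum>i\<in>I. Z i \<omega>) \<in> S}"
    and "prob {\<omega>\<in>space M. (\<Sum>i\<in>I. Z i \<omega>) \<in> S} \<le> real (card I) * ((1 + d) * \<phi> + C * \<phi> * r) + \<kappa>"
proof -
  have rv[measurable]: "random_variable borel (Z i)" if "i \<in> I" for i
    using ind that by (auto simp: indep_vars_def)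
  define R where "R i \<omega> = (\<Sum>j\<in>I-{i}. Z j \<omega>)" for i \<omega>
  define Q where "Q i \<omega> = (\<Sum>j\<in>I-{i}. \<bar>Z j \<omega>\<bar>)" for i \<omega>
  have RQ[measurable]: "random_variable borel (R i)" "random_variable borel (Q i)" for i
    unfolding R_def Q_def by measurable
  have RQle: "\<bar>R i \<omega>\<bar> \<le> Q i \<omega>" for i \<omega>
    unfolding R_def Q_def by (rule sum_abs)
  have tot: "(\<Sum>j\<in>I. Z j \<omega>) = Z i \<omega> + R i \<omega>" if "i \<in> I" for i \<omega>
    unfolding R_def using fin that by (rule sum.remove)
  have others: "indep_var borel (\<lambda>\<omega>. (Z i \<omega>, 0 :: real)) borel (\<lambda>\<omega>. (R i \<omega>, Q i \<omega>))" if "i \<in> I" for i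
    unfolding R_def Q_def by (rule indep_var_others[OF ind fin that])
  define Tot where "Tot \<omega> = (\<Sum>i\<in>I. Z i \<omega>)" for \<omega>
  have [measurable]: "random_variable borel Tot" unfolding Tot_def by measurable
  define A where "A i = {\<omega>\<in>space M. Tot \<omega> \<in> S \<and> Q i \<omega> \<le> \<epsilon> * x}" for i
  define A' where "A' i = {\<omega>\<in>space M. Tot \<omega> \<in> S \<and> Z i \<omega> > b \<and> Q i \<omega> > \<epsilon> * x}" for i
  define A0 where "A0 = {\<omega>\<in>space M. Tot \<omega> > x \<and> (\<forall>i\<in>I. Z i \<omega> \<le> b)}"
  have A_sets: "A i \<in> events" for i unfolding A_def by measurable
  have A'_sets: "A' i \<in> events" if "i \<in> I" for i unfolding A'_def using that by measurable
  have A0_sets: "A0 \<in> events" unfolding A0_def using fin by measurable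
  \<comment> \<open>The constraint \<open>\<bar>fst p\<bar> \<le> snd p\<close> always holds for the
    pair \<open>(R i, Q i)\<close>; built into \<open>B\<close>, it lets a frozen pair serve as a
    shift of size at most \<open>\<epsilon> * x\<close> in \<open>near\<close>.\<close>
  define B where "B = {p::real\<times>real. \<bar>fst p\<bar> \<le> snd p \<and> snd p \<le> \<epsilon> * x}"
  have B: "B \<in> sets borel"
    unfolding B_def by (intro borel_closed closed_Collect_conj closed_Collect_le continuous_intros)
  define E where "E = {p::(real\<times>real)\<times>(real\<times>real). fst (fst p) + fst (snd p) \<in> S \<and> snd p \<in> B}"
  have fst_fst[measurable]: "(\<lambda>p::(real\<times>real)\<times>(real\<times>real). fst (fst p)) \<in> borel_measurable borel"
    and fst_snd[measurable]: "(\<lambda>p::(real\<times>real)\<times>(real\<times>real). fst (snd p)) \<in> borel_measurable borel"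
    and snd[measurable]: "(snd :: (real\<times>real)\<times>(real\<times>real) \<Rightarrow> _) \<in> borel_measurable borel"
    by (intro borel_measurable_continuous_onI continuous_intros)+
  have E: "E \<in> sets (borel \<Otimes>\<^sub>M borel)"
    unfolding E_def borel_prod using B by measurable
  define B' where "B' = {p::real\<times>real. snd p > \<epsilon> * x}"
  have B': "B' \<in> sets borel"
    unfolding B'_def by (intro borel_open open_Collect_less continuous_intros)
  define E' where "E' = {p::(real\<times>real)\<times>(real\<times>real). fst (fst p) + fst (snd p) \<in> S \<and> fst (fst p) > b \<and> snd p \<in> B'}"
  have E': "E' \<in> sets (borel \<Otimes>\<^sub>M borel)"
    unfolding E'_def borel_prod using B' by measurable
  have A_eq: "A i = {\<omega>\<in>space M. ((Z i \<omega>, 0), (R i \<omega>, Q i \<omega>)) \<in> E}" if "i \<in> I" for i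
    using tot[OF that] RQle[of i] by (auto simp: A_def E_def B_def Tot_def)
  have B_eq: "{\<omega>\<in>space M. (R i \<omega>, Q i \<omega>) \<in> B} = space M - {\<omega>\<in>space M. Q i \<omega> > \<epsilon> * x}" for i
    using RQle[of i] by (auto simp: B_def)
  have A'_eq: "A' i = {\<omega>\<in>space M. ((Z i \<omega>, 0), (R i \<omega>, Q i \<omega>)) \<in> E'}" if "i \<in> I" for i
    using tot[OF that] by (auto simp: A'_def E'_def B'_def Tot_def)
  have Qr: "prob {\<omega>\<in>space M. Q i \<omega> > \<epsilon> * x} \<le> r" if "i \<in> I" for i
    using small[OF that] by (simp add: Q_def)
  have PB: "prob {\<omega>\<in>space M. (R i \<omega>, Q i \<omega>) \<in> B} \<ge> 1 - r" if "i \<in> I" for i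
    unfolding B_eq by (subst prob_compl) (use Qr[OF that] in auto)
  have lowA: "(1 - d) * \<phi> * (1 - r) \<le> prob (A i)" if i: "i \<in> I" for i
  proof -
    have "(1 - d) * \<phi> * (1 - r) \<le> (1 - d) * \<phi> * prob {\<omega>\<in>space M. (R i \<omega>, Q i \<omega>) \<in> B}"
      by (rule mult_left_mono[OF PB[OF i]]) (use d \<phi> in auto)
    also have "\<dots> \<le> prob (A i)" unfolding A_eq[OF i]
    proof (rule indep_var_section_bounds(2)[OF others[OF i] E B])
      fix y :: "real \<times> real"
      show "(1 - d) * \<phi> * indicator B y \<le> prob {\<omega>\<in>space M. ((Z i \<omega>, 0), y) \<in> E}"
      proof (cases "y \<in> B")
        case True
        then have "\<bar>fst y\<bar> \<le> \<epsilon> * x" by (auto simp: B_def)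
        from near[OF i this] True show ?thesis by (auto simp: E_def algebra_simps abs_le_iff)
      qed simp
    qed
    finally show ?thesis .
  qed
  have upA: "prob (A i) \<le> (1 + d) * \<phi>" if i: "i \<in> I" for i
  proof -
    have "prob (A i) \<le> (1 + d) * \<phi> * prob {\<omega>\<in>space M. (R i \<omega>, Q i \<omega>) \<in> B}"
      unfolding A_eq[OF i]
    proof (rule indep_var_section_bounds(1)[OF others[OF i] E B])
      fix y :: "real \<times> real"
      show "prob {\<omega>\<in>space M. ((Z i \<omega>, 0), y) \<in> E} \<le> (1 + d) * \<phi> * indicator B y"
      proof (cases "y \<in> B")
        case True
        then have "\<bar>fst y\<bar> \<le> \<epsilon> * x" by (auto simp: B_def)
        from near[OF i this] True show ?thesis by (auto simp: E_def algebra_simps abs_le_iff)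
      qed (simp add: E_def)
    qed
    also have "\<dots> \<le> (1 + d) * \<phi> * 1"
      by (rule mult_left_mono) (use d \<phi> in auto)
    finally show ?thesis by simp
  qed
  have upA': "prob (A' i) \<le> C * \<phi> * r" if i: "i \<in> I" for i
  proof -
    have "prob (A' i) \<le> C * \<phi> * prob {\<omega>\<in>space M. (R i \<omega>, Q i \<omega>) \<in> B'}"
      unfolding A'_eq[OF i]
    proof (rule indep_var_section_bounds(1)[OF others[OF i] E' B'])
      fix y :: "real \<times> real"
      show "prob {\<omega>\<in>space M. ((Z i \<omega>, 0), y) \<in> E'} \<le> C * \<phi> * indicator B' y"
        using far[OF i, of "fst y"] by (cases "y \<in> B'") (auto simp: E'_def)
    qed
    also have "\<dots> \<le> C * \<phi> * r"
      by (rule mult_left_mono) (use Qr[OF i] C \<phi> in \<open>auto simp: B'_def\<close>)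
    finally show ?thesis .
  qed
  have disj: "disjoint_family_on A I"
    unfolding disjoint_family_on_def
  proof (intro ballI impI)
    fix i j assume ij: "i \<in> I" "j \<in> I" "i \<noteq> j"
    have "\<omega> \<notin> A j" if "\<omega> \<in> A i" for \<omega>
    proof
      assume "\<omega> \<in> A j"
      have "\<bar>Z i \<omega>\<bar> \<le> Q j \<omega>"
        unfolding Q_def by (rule member_le_sum) (use ij fin in auto)
      moreover have "Z i \<omega> > x - \<epsilon> * x"
        using that tot[OF ij(1), of \<omega>] RQle[of i \<omega>] Sx by (auto simp: A_def Tot_def)
      moreover have "\<epsilon> * x \<le> 1/2 * x" by (rule mult_right_mono) (use e x in auto)
      ultimately show False using \<open>\<omega> \<in> A j\<close> by (auto simp: A_def)
    qed
    then show "A i \<inter> A j = {}" by blast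
  qed
  have un: "prob (\<Union>i\<in>I. A i) = (\<Sum>i\<in>I. prob (A i))"
    by (rule finite_measure_finite_Union[OF fin _ disj]) (use A_sets in auto)
  have "real (card I) * ((1 - d) * \<phi> * (1 - r)) = (\<Sum>i\<in>I. (1 - d) * \<phi> * (1 - r))" by simp
  also have "\<dots> \<le> prob (\<Union>i\<in>I. A i)" unfolding un by (rule sum_mono) (rule lowA)
  also have "\<dots> \<le> prob {\<omega>\<in>space M. Tot \<omega> \<in> S}"
    by (rule finite_measure_mono) (auto simp: A_def)
  finally show "real (card I) * ((1 - d) * \<phi> * (1 - r)) \<le> prob {\<omega>\<in>space M. (\<Sum>i\<in>I. Z i \<omega>) \<in> S}"
    by (simp add: Tot_def)
  have U'_sets: "(\<Union>i\<in>I. A' i) \<in> events" using fin A'_sets by auto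
  have U_sets: "(\<Union>i\<in>I. A i) \<in> events" using fin A_sets by auto
  \<comment> \<open>Outside all \<open>A i\<close> every \<open>Q i\<close> exceeds
    \<open>\<epsilon> * x\<close>; then a summand above \<open>b\<close> puts the outcome into
    \<open>A' i\<close>, and without such a summand it lies in \<open>A0\<close> because
    \<open>S\<close> lies above \<open>x\<close>.\<close>
  have "prob {\<omega>\<in>space M. Tot \<omega> \<in> S} \<le> prob (((\<Union>i\<in>I. A i) \<union> (\<Union>i\<in>I. A' i)) \<union> A0)"
  proof (rule finite_measure_mono)
    show "{\<omega>\<in>space M. Tot \<omega> \<in> S} \<subseteq> ((\<Union>i\<in>I. A i) \<union> (\<Union>i\<in>I. A' i)) \<union> A0"
      using Sx by (force simp: A_def A'_def A0_def not_le)
  qed (use U_sets U'_sets A0_sets in auto)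
  also have "\<dots> \<le> prob ((\<Union>i\<in>I. A i) \<union> (\<Union>i\<in>I. A' i)) + prob A0"
    by (rule measure_Un_le) (use U_sets U'_sets A0_sets in auto)
  also have "prob ((\<Union>i\<in>I. A i) \<union> (\<Union>i\<in>I. A' i)) \<le> prob (\<Union>i\<in>I. A i) + prob (\<Union>i\<in>I. A' i)"
    by (rule measure_Un_le) (use U_sets U'_sets in auto)
  also have "prob (\<Union>i\<in>I. A i) \<le> (\<Sum>i\<in>I. (1 + d) * \<phi>)"
    unfolding un by (rule sum_mono) (rule upA)
  also have "prob (\<Union>i\<in>I. A' i) \<le> (\<Sum>i\<in>I. prob (A' i))"
    by (rule finite_measure_subadditive_finite[OF fin]) (use A'_sets in auto)
  also have "\<dots> \<le> (\<Sum>i\<in>I. C * \<phi> * r)" by (rule sum_mono) (rule upA')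
  also have "prob A0 \<le> \<kappa>" using none by (simp add: A0_def Tot_def)
  finally show "prob {\<omega>\<in>space M. (\<Sum>i\<in>I. Z i \<omega>) \<in> S} \<le> real (card I) * ((1 + d) * \<phi> + C * \<phi> * r) + \<kappa>"
    by (simp add: Tot_def algebra_simps)
qed

subsection \<open>Window probabilities\<close>

lemma mem_shifted_Delta: "w \<in> shifted_Delta T z \<longleftrightarrow> z < w \<and> ereal (w - z) \<le> T"
  by (force simp: shifted_Delta_def Delta_def image_iff intro: exI[of _ "w - z"])

lemma shifted_Delta_PInf: "shifted_Delta \<infinity> z = {z<..}"
  by (auto simp: mem_shifted_Delta)

lemma shifted_Delta_real: "shifted_Delta (ereal t) z = {z<..z+t}"
  by (auto simp: mem_shifted_Delta)

lemma shifted_Delta_borel[measurable]: "shifted_Delta T z \<in> sets borel"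
proof -
  have "shifted_Delta T z = {w. z < w \<and> ereal (w - z) \<le> T}" by (auto simp: mem_shifted_Delta)
  also have "\<dots> \<in> sets borel" by measurable
  finally show ?thesis .
qed

lemma add_mem_shifted_Delta: "w + s \<in> shifted_Delta T z \<longleftrightarrow> w \<in> shifted_Delta T (z - s)"
  by (auto simp: mem_shifted_Delta algebra_simps)

text \<open>The window probability is almost constant on \<open>{x..(1 + \<epsilon>) * x}\<close>, which contains about
  \<open>\<epsilon> * x / t\<close> disjoint windows, so it is \<open>O(1 / x)\<close>.\<close>

lemma (in prob_space) window_index_neg:
  fixes Z :: "'a \<Rightarrow> real"
  assumes Z[measurable]: "random_variable borel Z" and t: "t > 0"
    and rv: "regularly_varying (\<lambda>y. prob {\<omega>\<in>space M. Z \<omega> \<in> {y<..y+t}}) \<rho>"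
  shows "\<rho> < 0"
proof (rule ccontr)
  assume "\<not> \<rho> < 0"
  define f where "f y = prob {\<omega>\<in>space M. Z \<omega> \<in> {y<..y+t}}" for y
  have rvf: "regularly_varying f \<rho>" using rv by (simp add: f_def[abs_def])
  obtain \<epsilon> X where e: "\<epsilon> > 0" and X: "\<And>x y. x \<ge> X \<Longrightarrow> \<bar>y - x\<bar> \<le> \<epsilon> * x \<Longrightarrow> \<bar>f y - f x\<bar> \<le> 1/2 * f x"
    using regularly_varying_slow_change[OF rvf, of "1/2"] by auto
  \<comment> \<open>For a nonnegative index each window would carry at least half of
    \<open>x powr (- 1/2)\<close>, and about \<open>\<epsilon> * x / t\<close> disjoint windows
    would have total mass of order \<open>x powr (1/2)\<close>, more than 1.\<close>
  have "\<forall>\<^sub>F x in at_top. f x \<ge> x powr (- 1/2)"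
    by (rule regularly_varying_eventually_ge_powr[OF rvf]) (use \<open>\<not> \<rho> < 0\<close> in auto)
  moreover have "\<forall>\<^sub>F x in at_top. (\<epsilon> * x / t - 1) * (1/2 * x powr (- 1/2)) > 1"
    using e t by real_asymp
  ultimately have "\<forall>\<^sub>F x in at_top. f x \<ge> x powr (- 1/2) \<and> (\<epsilon> * x / t - 1) * (1/2 * x powr (- 1/2)) > 1
      \<and> x \<ge> X \<and> x > 0"
    using eventually_ge_at_top[of X] eventually_gt_at_top[of 0] by eventually_elim auto
  then obtain x where x: "f x \<ge> x powr (- 1/2)" "(\<epsilon> * x / t - 1) * (1/2 * x powr (- 1/2)) > 1" "x \<ge> X" "x > 0"
    unfolding eventually_at_top_linorder by blast
  define N where "N = nat \<lfloor>\<epsilon> * x / t\<rfloor>"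
  have ext: "\<epsilon> * x / t \<ge> 0" using e x t by simp
  have N: "real N \<le> \<epsilon> * x / t" "real N \<ge> \<epsilon> * x / t - 1"
    unfolding N_def using ext by linarith+
  define W where "W j = {\<omega>\<in>space M. Z \<omega> \<in> {x + real j * t<..x + real j * t + t}}" for j :: nat
  have disj: "disjoint_family_on W {..<N}"
    unfolding disjoint_family_on_def
  proof (intro ballI impI)
    fix i j :: nat assume "i \<noteq> j"
    then consider "real i + 1 \<le> real j" | "real j + 1 \<le> real i" by linarith
    then show "W i \<inter> W j = {}"
    proof cases
      case 1
      then have "(real i + 1) * t \<le> real j * t" using t by (intro mult_right_mono) auto
      then show ?thesis by (auto simp: W_def algebra_simps)
    next
      case 2
      then have "(real j + 1) * t \<le> real i * t" using t by (intro mult_right_mono) auto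
      then show ?thesis by (auto simp: W_def algebra_simps)
    qed
  qed
  have W_ge: "prob (W j) \<ge> 1/2 * x powr (- 1/2)" if "j < N" for j
  proof -
    have "real j * t \<le> real N * t" using that t by (intro mult_right_mono) auto
    also have "\<dots> \<le> \<epsilon> * x" using N(1) t by (simp add: field_simps)
    finally have "\<bar>f (x + real j * t) - f x\<bar> \<le> 1/2 * f x"
      using t by (intro X x(3)) auto
    then have "f (x + real j * t) \<ge> 1/2 * f x" by linarith
    then show ?thesis using x(1) by (simp add: f_def W_def)
  qed
  have "1 < (\<epsilon> * x / t - 1) * (1/2 * x powr (- 1/2))" by (rule x(2))
  also have "\<dots> \<le> real N * (1/2 * x powr (- 1/2))"
    using N(2) by (rule mult_right_mono) auto
  also have "\<dots> = (\<Sum>j<N. 1/2 * x powr (- 1/2))" by simp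
  also have "\<dots> \<le> (\<Sum>j<N. prob (W j))" by (rule sum_mono) (use W_ge in auto)
  also have "\<dots> = prob (\<Union>j<N. W j)"
    by (rule finite_measure_finite_Union[symmetric, OF _ _ disj]) (auto simp: W_def)
  also have "\<dots> \<le> 1" by simp
  finally show False by simp
qed

text \<open>The shift \<open>s\<close> is arbitrary, so the window starts at \<open>x - s\<close>.
  From \<open>\<eta> / 2 * x\<close> on, almost monotonicity and regular variation compare it with
  the window at \<open>x\<close>. Further left, a finite window of length at most
  \<open>\<eta> / 2 * x\<close> ends before \<open>\<eta> * x\<close> and the event is empty; for an
  infinite \<open>T\<close> the condition \<open>Z > \<eta> * x\<close> alone suffices.\<close>

lemma (in prob_space) shifted_Delta_truncated_le:
  fixes Z :: "'a \<Rightarrow> real"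
  assumes Z[measurable]: "random_variable borel Z"
    and rv: "regularly_varying (\<lambda>y. prob {\<omega>\<in>space M. Z \<omega> \<in> shifted_Delta T y}) \<rho>"
    and neg: "\<rho> < 0" and \<eta>: "\<eta> > 0"
  shows "\<exists>C>0. \<forall>\<^sub>F x in at_top. \<forall>s.
    prob {\<omega>\<in>space M. Z \<omega> + s \<in> shifted_Delta T x \<and> Z \<omega> > \<eta> * x}
      \<le> C * prob {\<omega>\<in>space M. Z \<omega> \<in> shifted_Delta T x}"
proof -
  define f where "f y = prob {\<omega>\<in>space M. Z \<omega> \<in> shifted_Delta T y}" for y
  have rvf: "regularly_varying f \<rho>" using rv by (simp add: f_def[abs_def])
  obtain C1 X1 where C1: "C1 > 0" "\<And>x y. x \<ge> X1 \<Longrightarrow> y \<ge> x \<Longrightarrow> f y \<le> C1 * f x"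
    using regularly_varying_almost_decreasing[OF rvf neg] by blast
  define C2 where "C2 = (\<eta> / 2) powr \<rho> + 1"
  have C2: "C2 > 0" by (simp add: C2_def add_nonneg_pos)
  have "((\<lambda>x. f (\<eta> / 2 * x) / f x) \<longlongrightarrow> (\<eta> / 2) powr \<rho>) at_top"
    using rvf \<eta> unfolding regularly_varying_def by (meson half_gt_zero)
  then have ev: "\<forall>\<^sub>F x in at_top. f (\<eta> / 2 * x) / f x < C2"
    by (rule order_tendstoD) (simp add: C2_def)
  have evT: "\<forall>\<^sub>F x in at_top. T = \<infinity> \<or> T \<le> ereal (\<eta> / 2 * x)"
  proof (cases T)
    case (real t)
    have "\<forall>\<^sub>F x in at_top. t \<le> \<eta> / 2 * x" using \<eta> by real_asymp
    then show ?thesis using real by simp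
  qed auto
  have "\<forall>\<^sub>F x in at_top. \<eta> / 2 * x \<ge> X1" using \<eta> by real_asymp
  then have "\<forall>\<^sub>F x in at_top. \<forall>s.
      prob {\<omega>\<in>space M. Z \<omega> + s \<in> shifted_Delta T x \<and> Z \<omega> > \<eta> * x} \<le> C1 * C2 * f x"
    using ev evT regularly_varying_eventually_pos[OF rvf] eventually_gt_at_top[of 0]
      eventually_gt_at_top[of X1]
  proof eventually_elim
    case (elim x)
    have h: "f (\<eta> / 2 * x) \<le> C2 * f x" using elim by (simp add: field_simps)
    have hx: "\<eta> / 2 * x < \<eta> * x" using elim \<eta> by simp
    show ?case
    proof
      fix s
      let ?P = "prob {\<omega>\<in>space M. Z \<omega> + s \<in> shifted_Delta T x \<and> Z \<omega> > \<eta> * x}"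
      have bound: "?P \<le> C1 * f (\<eta> / 2 * x)"
      proof (cases "\<eta> / 2 * x \<le> x - s")
        case True
        have "?P \<le> f (x - s)"
          unfolding f_def by (rule finite_measure_mono) (auto simp: add_mem_shifted_Delta)
        also have "\<dots> \<le> C1 * f (\<eta> / 2 * x)"
          by (rule C1(2)) (use True elim in auto)
        finally show ?thesis .
      next
        case False
        show ?thesis
        proof (cases "T = \<infinity>")
          case True
          have "?P \<le> f (\<eta> / 2 * x)"
            unfolding f_def by (rule finite_measure_mono) (use hx True in \<open>auto simp: shifted_Delta_PInf\<close>)
          also have "\<dots> \<le> C1 * f (\<eta> / 2 * x)" by (rule C1(2)) (use elim in auto)
          finally show ?thesis .
        next
          case fin: False
          have empty: "{\<omega>\<in>space M. Z \<omega> + s \<in> shifted_Delta T x \<and> Z \<omega> > \<eta> * x} = {}"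
          proof safe
            fix \<omega> assume "Z \<omega> + s \<in> shifted_Delta T x" "Z \<omega> > \<eta> * x"
            then have "ereal (Z \<omega> + s - x) \<le> T" by (simp add: mem_shifted_Delta)
            also have "T \<le> ereal (\<eta> / 2 * x)" using elim fin by simp
            finally show "\<omega> \<in> {}" using False \<open>Z \<omega> > \<eta> * x\<close> by simp
          qed
          show ?thesis unfolding empty using C1(1) by (simp add: f_def)
        qed
      qed
      also have "\<dots> \<le> C1 * (C2 * f x)" by (rule mult_left_mono[OF h]) (use C1 in auto)
      finally show "?P \<le> C1 * C2 * f x" by simp
    qed
  qed
  then show ?thesis using C1(1) C2 unfolding f_def by (intro exI[of _ "C1 * C2"]) auto
qed

subsection \<open>Uniform asymptotics\<close>

text \<open>The asymptotics are stated for all pairs \<open>(n, x)\<close> with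
  \<open>n * P(\<xi> \<le> - x) \<le> \<delta>\<close>, where neither \<delta> nor the threshold for
  \<open>x\<close> depends on \<open>n\<close>; this is what makes the result uniform along any
  admissible sequence.\<close>

lemma (in prob_space) uniform_big_jump:
  fixes \<xi> :: "nat \<Rightarrow> 'a \<Rightarrow> real" and T :: ereal
  assumes ind: "indep_vars (\<lambda>_. borel) \<xi> UNIV"
    and id: "\<And>i. distr M borel (\<xi> i) = distr M borel (\<xi> 0)"
    and alpha: "0 < \<alpha>" "\<alpha> < 1" and beta: "\<alpha> < \<beta>"
    and left: "regularly_varying (\<lambda>y. prob {\<omega>\<in>space M. \<xi> 0 \<omega> \<le> - y}) (- \<alpha>)"
    and right: "regularly_varying (\<lambda>y. prob {\<omega>\<in>space M. \<xi> 0 \<omega> > y}) (- \<beta>)"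
    and rv: "regularly_varying (\<lambda>y. prob {\<omega>\<in>space M. \<xi> 0 \<omega> \<in> shifted_Delta T y}) \<rho>"
    and neg: "\<rho> < 0" and e: "e > 0"
  shows "\<exists>\<delta>>0. \<forall>\<^sub>F x in at_top. \<forall>n\<ge>1. real n * prob {\<omega>\<in>space M. \<xi> 0 \<omega> \<le> - x} \<le> \<delta> \<longrightarrow>
    \<bar>prob {\<omega>\<in>space M. partial_sum \<xi> n \<omega> \<in> shifted_Delta T x}
      / (real n * prob {\<omega>\<in>space M. \<xi> 0 \<omega> \<in> shifted_Delta T x}) - 1\<bar> \<le> e"
proof -
  have rnd[measurable]: "random_variable borel (\<xi> i)" for i
    using ind by (auto simp: indep_vars_def)
  define f where "f y = prob {\<omega>\<in>space M. \<xi> 0 \<omega> \<in> shifted_Delta T y}" for y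
  define L where "L y = prob {\<omega>\<in>space M. \<xi> 0 \<omega> \<le> - y}" for y
  have rvf: "regularly_varying f \<rho>" and rvL: "regularly_varying L (- \<alpha>)"
    using rv left by (simp_all add: f_def[abs_def] L_def[abs_def])
  have L_anti: "antimono L"
    unfolding L_def by (intro antimonoI finite_measure_mono) auto
  have P_id: "prob {\<omega>\<in>space M. \<xi> i \<omega> \<in> A} = prob {\<omega>\<in>space M. \<xi> 0 \<omega> \<in> A}" if "A \<in> sets borel" for i A
  proof -
    have "measure (distr M borel (\<xi> i)) A = measure (distr M borel (\<xi> 0)) A" by (simp only: id[of i])
    then show ?thesis using that by (simp add: measure_distr vimage_def Int_def conj_commute)
  qed
  have E_id: "expectation (\<lambda>\<omega>. h (\<xi> i \<omega>)) = expectation (\<lambda>\<omega>. h (\<xi> 0 \<omega>))"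
    if [measurable]: "h \<in> borel_measurable borel" for i and h :: "real \<Rightarrow> real"
  proof -
    have "(\<integral>z. h z \<partial>distr M borel (\<xi> i)) = (\<integral>z. h z \<partial>distr M borel (\<xi> 0))" by (simp only: id[of i])
    then show ?thesis by (simp add: integral_distr)
  qed
  obtain \<epsilon>0 X0 where e0: "\<epsilon>0 > 0" and
    X0: "\<And>x y. x \<ge> X0 \<Longrightarrow> \<bar>y - x\<bar> \<le> \<epsilon>0 * x \<Longrightarrow> \<bar>f y - f x\<bar> \<le> min 1 (e / 3) * f x"
    using regularly_varying_slow_change[OF rvf, of "min 1 (e / 3)"] e by auto
  define \<epsilon> where "\<epsilon> = min \<epsilon>0 (1/2)"
  have \<epsilon>: "0 < \<epsilon>" "\<epsilon> \<le> 1/2" "\<epsilon> \<le> \<epsilon>0" using e0 by (auto simp: \<epsilon>_def)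
  \<comment> \<open>The Chernoff term \<open>x powr (- K)\<close> is then
    \<open>x powr (\<rho> - 1) / x\<close>, hence at most \<open>f x / x\<close> by the power lower
    bound for \<open>f\<close>.\<close>
  define K where "K = 2 - \<rho>"
  have K: "K > 0" using neg by (simp add: K_def)
  obtain \<eta> where \<eta>: "\<eta> > 0" and mgf: "\<forall>\<^sub>F x in at_top.
      expectation (\<lambda>\<omega>. exp (K * ln x / x * \<xi> 0 \<omega>) * indicator {..\<eta> * x} (\<xi> 0 \<omega>)) \<le> 1"
    using truncated_mgf_le_1[OF rnd left right alpha beta K] by blast
  obtain C where C: "C > 0" and far: "\<forall>\<^sub>F x in at_top. \<forall>s.
      prob {\<omega>\<in>space M. \<xi> 0 \<omega> + s \<in> shifted_Delta T x \<and> \<xi> 0 \<omega> > \<eta> * x} \<le> C * f x"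
    using shifted_Delta_truncated_le[OF rnd rv neg \<eta>] unfolding f_def by blast
  \<comment> \<open>An exponent strictly between \<alpha> and \<beta> separates the tails: the right
    one is eventually below the left one, so the tail of the absolute value is at most
    \<open>2 * L x\<close>.\<close>
  define \<sigma> where "\<sigma> = (\<alpha> + \<beta>) / 2"
  have "\<forall>\<^sub>F x in at_top. prob {\<omega>\<in>space M. \<xi> 0 \<omega> > x} \<le> x powr (- \<sigma>)"
    by (rule regularly_varying_eventually_le_powr[OF right]) (use beta in \<open>simp add: \<sigma>_def\<close>)
  moreover have "\<forall>\<^sub>F x in at_top. L x \<ge> x powr (- \<sigma>)"
    by (rule regularly_varying_eventually_ge_powr[OF rvL]) (use beta in \<open>simp add: \<sigma>_def\<close>)
  ultimately have tail: "\<forall>\<^sub>F x in at_top. prob {\<omega>\<in>space M. \<bar>\<xi> 0 \<omega>\<bar> > x} \<le> 2 * L x"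
  proof eventually_elim
    case (elim x)
    have "prob {\<omega>\<in>space M. \<bar>\<xi> 0 \<omega>\<bar> > x}
        \<le> prob ({\<omega>\<in>space M. \<xi> 0 \<omega> > x} \<union> {\<omega>\<in>space M. \<xi> 0 \<omega> \<le> - x})"
      by (rule finite_measure_mono) auto
    also have "\<dots> \<le> prob {\<omega>\<in>space M. \<xi> 0 \<omega> > x} + L x"
      unfolding L_def by (rule measure_Un_le) auto
    finally show ?case using elim by linarith
  qed
  obtain D where D: "D > 0" and mean: "\<forall>\<^sub>F x in at_top. expectation (\<lambda>\<omega>. min \<bar>\<xi> 0 \<omega>\<bar> x) \<le> D * (x * L x)"
    using truncated_mean_regularly_varying[OF _ _ rvL alpha(2) L_anti tail] by auto
  define r where "r = min 1 (e / 3) / (1 + C)"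
  have r: "r > 0" "r \<le> e / 3" "C * r \<le> e / 3"
  proof -
    show "r > 0" using e C by (simp add: r_def)
    have "r * (1 + C) = min 1 (e / 3)" using C by (simp add: r_def)
    then have "r + C * r \<le> e / 3" by (simp add: algebra_simps)
    moreover have "C * r \<ge> 0" using C \<open>r > 0\<close> by simp
    ultimately show "r \<le> e / 3" "C * r \<le> e / 3" using \<open>r > 0\<close> by linarith+
  qed
  \<comment> \<open>Chosen so that the Markov bound
    \<open>n * D * x * L x / (\<epsilon> * x)\<close> for the other summands is at most
    \<open>r\<close>.\<close>
  define \<delta> where "\<delta> = r * \<epsilon> / D"
  have \<delta>: "\<delta> > 0" using r \<epsilon> D by (simp add: \<delta>_def)
  have fK: "\<forall>\<^sub>F x in at_top. f x \<ge> x powr (\<rho> - 1)"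
    by (rule regularly_varying_eventually_ge_powr[OF rvf]) simp
  have "\<forall>\<^sub>F x in at_top. \<forall>n\<ge>1. real n * L x \<le> \<delta> \<longrightarrow>
    \<bar>prob {\<omega>\<in>space M. partial_sum \<xi> n \<omega> \<in> shifted_Delta T x} / (real n * f x) - 1\<bar> \<le> e"
    using fK mean far mgf eventually_ge_at_top[of X0] eventually_ge_at_top[of "3 / e"]
      eventually_gt_at_top[of 1]
  proof eventually_elim
    case (elim x)
    have x: "x > 1" "x > 0" "x \<ge> X0" "x \<ge> 3 / e" using elim by auto
    have fx: "f x \<ge> x powr (\<rho> - 1)" "f x > 0" using elim x by (auto intro: less_le_trans[rotated])
    show ?case
    proof (intro allI impI)
      fix n :: nat assume n: "n \<ge> 1" and nL: "real n * L x \<le> \<delta>"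
      define P where "P = prob {\<omega>\<in>space M. (\<Sum>i=1..n. \<xi> i \<omega>) \<in> shifted_Delta T x}"
      have ind': "indep_vars (\<lambda>_. borel) \<xi> {1..n}"
        by (rule indep_vars_subset[OF ind]) auto
      have Sx: "shifted_Delta T x \<subseteq> {x<..}" by (auto simp: mem_shifted_Delta)
      have near: "\<bar>prob {\<omega>\<in>space M. \<xi> i \<omega> + s \<in> shifted_Delta T x} - f x\<bar> \<le> min 1 (e / 3) * f x"
        if "\<bar>s\<bar> \<le> \<epsilon> * x" for i s
      proof -
        have "\<epsilon> * x \<le> \<epsilon>0 * x" using \<epsilon> x by (intro mult_right_mono) auto
        then have "\<bar>f (x - s) - f x\<bar> \<le> min 1 (e / 3) * f x"
          using that by (intro X0 x) auto
        then show ?thesis by (simp add: add_mem_shifted_Delta P_id[of _ i] f_def)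
      qed
      have far': "prob {\<omega>\<in>space M. \<xi> i \<omega> + s \<in> shifted_Delta T x \<and> \<xi> i \<omega> > \<eta> * x} \<le> C * f x" for i s
        using P_id[of "shifted_Delta T (x - s) \<inter> {\<eta> * x<..}" i] elim
        by (simp add: add_mem_shifted_Delta)
      have small: "prob {\<omega>\<in>space M. (\<Sum>j\<in>{1..n}-{i}. \<bar>\<xi> j \<omega>\<bar>) > \<epsilon> * x} \<le> r" for i
      proof -
        have "prob {\<omega>\<in>space M. (\<Sum>j\<in>{1..n}-{i}. \<bar>\<xi> j \<omega>\<bar>) > \<epsilon> * x}
            \<le> real (card ({1..n}-{i})) * (D * (x * L x)) / (\<epsilon> * x)"
        proof (rule sum_tail_le_truncated_mean)
          fix j
          show "expectation (\<lambda>\<omega>. min \<bar>\<xi> j \<omega>\<bar> x) \<le> D * (x * L x)"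
            using E_id[of "\<lambda>z. min \<bar>z\<bar> x" j] elim by simp
        qed (use \<epsilon> x in auto)
        also have "\<dots> \<le> real n * (D * (x * L x)) / (\<epsilon> * x)"
          using D \<epsilon> x card_mono[of "{1..n}" "{1..n}-{i}"]
          by (intro divide_right_mono mult_right_mono) (auto simp: L_def)
        also have "\<dots> = D / \<epsilon> * (real n * L x)" using x by (simp add: field_simps)
        also have "\<dots> \<le> D / \<epsilon> * \<delta>" using nL D \<epsilon> by (intro mult_left_mono) auto
        also have "\<dots> = r" using D \<epsilon> by (simp add: \<delta>_def)
        finally show ?thesis .
      qed
      have "prob {\<omega>\<in>space M. (\<Sum>i\<in>{1..n}. \<xi> i \<omega>) > x \<and> (\<forall>i\<in>{1..n}. \<xi> i \<omega> \<le> \<eta> * x)}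
          \<le> exp (- (K * ln x / x) * x)"
      proof (rule Chernoff_truncated_sum[OF ind'])
        fix i
        show "expectation (\<lambda>\<omega>. exp (K * ln x / x * \<xi> i \<omega>) * indicator {..\<eta> * x} (\<xi> i \<omega>)) \<le> 1"
          using E_id[of "\<lambda>z. exp (K * ln x / x * z) * indicator {..\<eta> * x} z" i] elim by simp
      qed (use K x in auto)
      also have "exp (- (K * ln x / x) * x) = x powr (- K)"
        using x by (simp add: powr_def)
      also have "x powr (- K) = x powr (\<rho> - 1) * (1 / x)"
        using x powr_add[of x "\<rho> - 1" "- 1"] by (simp add: K_def powr_minus field_simps)
      also have "\<dots> \<le> f x * (e / 3)"
        using fx x e by (intro mult_mono) (auto simp: field_simps)
      finally have none: "prob {\<omega>\<in>space M. (\<Sum>i\<in>{1..n}. \<xi> i \<omega>) > x \<and> (\<forall>i\<in>{1..n}. \<xi> i \<omega> \<le> \<eta> * x)}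
          \<le> f x * (e / 3)" .
      define d where "d = min 1 (e / 3)"
      have d: "0 \<le> d" "d \<le> 1" "d \<le> e / 3" using e by (auto simp: d_def)
      note bounds = big_jump_bounds[OF ind' _ shifted_Delta_borel Sx x(2) \<epsilon>(1,2) _ d(1,2) _
          near[folded d_def] far' small none]
      have low: "real n * ((1 - d) * f x * (1 - r)) \<le> P"
        using bounds(1) fx C by (simp add: P_def)
      have up: "P \<le> real n * ((1 + d) * f x + C * f x * r) + f x * (e / 3)"
        using bounds(2) fx C by (simp add: P_def)
      have nf: "real n * f x > 0" using n fx by simp
      have "1 - e \<le> (1 - d) * (1 - r)"
      proof -
        have "(1 - d) * (1 - r) = 1 - d - r + d * r" by (simp add: algebra_simps)
        moreover have "d * r \<ge> 0" using d r by simp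
        ultimately show ?thesis using d r e by linarith
      qed
      then have "(1 - e) * (real n * f x) \<le> (1 - d) * (1 - r) * (real n * f x)"
        using nf by (intro mult_right_mono) auto
      also have "\<dots> \<le> P" using low by (simp add: mult_ac)
      finally have lo: "1 - e \<le> P / (real n * f x)" using nf by (simp add: pos_le_divide_eq)
      \<comment> \<open>Since \<open>n \<ge> 1\<close>, the Chernoff term is charged to the main
        term; the three errors \<open>d\<close>, \<open>C * r\<close> and \<open>e / 3\<close> then
        add up to at most \<open>e\<close>.\<close>
      have "f x * (e / 3) \<le> (real n * f x) * (e / 3)"
        using n fx e by (intro mult_right_mono) auto
      then have "P \<le> (real n * f x) * (1 + d + C * r + e / 3)"
        using up by (simp add: algebra_simps)
      also have "\<dots> \<le> (real n * f x) * (1 + e)"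
        using nf d r by (intro mult_left_mono) linarith+
      finally have "P / (real n * f x) \<le> 1 + e" using nf by (simp add: pos_divide_le_eq mult.commute)
      with lo show "\<bar>prob {\<omega>\<in>space M. partial_sum \<xi> n \<omega> \<in> shifted_Delta T x} / (real n * f x) - 1\<bar> \<le> e"
        by (simp add: P_def partial_sum_def abs_le_iff)
    qed
  qed
  then show ?thesis using \<delta> unfolding f_def L_def by blast
qed

theorem theorem9p3:
  fixes M :: "'a measure" and \<xi> :: "nat \<Rightarrow> 'a \<Rightarrow> real"
    and T :: ereal and \<alpha> \<beta> :: real and x :: "nat \<Rightarrow> real"
  assumes iid: "iid_sequence M \<xi>"
    and T_pos: "0 < T"
    and alpha: "0 < \<alpha>" "\<alpha> < 1"
    and beta: "\<alpha> < \<beta>"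
    and left_tail: "regularly_varying (\<lambda>y. \<P>(\<omega> in M. \<xi> 0 \<omega> \<le> - y)) (- \<alpha>)"
    and right_tail: "regularly_varying (\<lambda>y. \<P>(\<omega> in M. \<xi> 0 \<omega> > y)) (- \<beta>)"
    and local_tail: "T < \<infinity> \<Longrightarrow>
      \<exists>\<rho>. regularly_varying (\<lambda>y. \<P>(\<omega> in M. \<xi> 0 \<omega> \<in> shifted_Delta T y)) \<rho>"
    and x: "(\<lambda>n. real n * \<P>(\<omega> in M. \<xi> 0 \<omega> \<le> - x n)) \<in> o(\<lambda>_. 1)"
  shows "(\<lambda>n. SUP y\<in>{x n..}.
      ereal \<bar>\<P>(\<omega> in M. partial_sum \<xi> n \<omega> \<in> shifted_Delta T y)
        / (real n * \<P>(\<omega> in M. \<xi> 0 \<omega> \<in> shifted_Delta T y)) - 1\<bar>) \<longlonglongrightarrow> 0"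
proof -
  from iid have "prob_space M" and ind: "prob_space.indep_vars M (\<lambda>_. borel) \<xi> UNIV"
    and id: "\<And>i. distr M borel (\<xi> i) = distr M borel (\<xi> 0)"
    unfolding iid_sequence_def by blast+
  interpret prob_space M by fact
  have rnd[measurable]: "random_variable borel (\<xi> i)" for i
    using ind by (auto simp: indep_vars_def)
  \<comment> \<open>Both forms of the window are unified here: for finite \<open>T\<close> the sign
    of the index has to be proved, while for infinite \<open>T\<close> the window probability is the
    right tail, of index -\<beta>.\<close>
  obtain \<rho> where rv: "regularly_varying (\<lambda>y. prob {\<omega>\<in>space M. \<xi> 0 \<omega> \<in> shifted_Delta T y}) \<rho>" and neg: "\<rho> < 0"
  proof (cases T)
    case (real t)
    then obtain \<rho> where rv: "regularly_varying (\<lambda>y. prob {\<omega>\<in>space M. \<xi> 0 \<omega> \<in> shifted_Delta T y}) \<rho>"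
      using local_tail by auto
    have "\<rho> < 0"
      by (rule window_index_neg[OF rnd, of t]) (use T_pos rv real in \<open>simp_all add: shifted_Delta_real\<close>)
    with rv show ?thesis by (rule that)
  next
    case PInf
    show ?thesis
      by (rule that[of "- \<beta>"]) (use right_tail alpha beta in \<open>simp_all add: PInf shifted_Delta_PInf\<close>)
  qed (use T_pos in auto)
  define L where "L y = prob {\<omega>\<in>space M. \<xi> 0 \<omega> \<le> - y}" for y
  have L_anti: "L z \<le> L y" if "y \<le> z" for y z
    unfolding L_def by (intro finite_measure_mono) (use that in auto)
  have L_pos: "L y > 0" for y
  proof -
    obtain A where A: "\<And>y. y \<ge> A \<Longrightarrow> L y > 0"
      using regularly_varying_eventually_pos[OF left_tail] unfolding L_def eventually_at_top_linorder by blast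
    have "L (max A y) > 0" by (rule A) simp
    also have "L (max A y) \<le> L y" by (rule L_anti) simp
    finally show ?thesis .
  qed
  have nL: "(\<lambda>n. real n * L (x n)) \<longlonglongrightarrow> 0"
    using smalloD_tendsto[OF x] by (simp add: L_def)
  \<comment> \<open>Since \<open>L\<close> is antitone and positive everywhere,
    \<open>L (x n)\<close> falling below \<open>L X\<close> forces \<open>x n\<close> beyond
    \<open>X\<close>.\<close>
  have x_large: "\<forall>\<^sub>F n in sequentially. x n \<ge> X" for X
    using order_tendstoD(2)[OF nL L_pos[of X]] eventually_ge_at_top[of 1]
  proof eventually_elim
    case (elim n)
    have "1 * L (x n) \<le> real n * L (x n)"
      using elim L_pos[of "x n"] by (intro mult_right_mono) auto
    then have "L (x n) < L X" using elim by simp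
    then show ?case using L_anti[of "x n" X] by linarith
  qed
  define g where "g n y = \<bar>prob {\<omega>\<in>space M. partial_sum \<xi> n \<omega> \<in> shifted_Delta T y}
      / (real n * prob {\<omega>\<in>space M. \<xi> 0 \<omega> \<in> shifted_Delta T y}) - 1\<bar>" for n y
  have unif: "\<forall>\<^sub>F n in sequentially. \<forall>y\<ge>x n. g n y \<le> e" if e: "e > 0" for e
  proof -
    obtain \<delta> X where \<delta>: "\<delta> > 0" and X: "\<And>y n. y \<ge> X \<Longrightarrow> n \<ge> 1 \<Longrightarrow> real n * L y \<le> \<delta> \<Longrightarrow> g n y \<le> e"
      using uniform_big_jump[OF ind id alpha beta left_tail right_tail rv neg e]
      unfolding L_def g_def eventually_at_top_linorder by blast
    show ?thesis
      using order_tendstoD(2)[OF nL \<delta>] eventually_ge_at_top[of 1] x_large[of X]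
    proof eventually_elim
      case (elim n)
      show ?case
      proof (intro allI impI X)
        fix y assume "y \<ge> x n"
        \<comment> \<open>Monotonicity of \<open>L\<close> passes the smallness at
          \<open>x n\<close> on to every \<open>y \<ge> x n\<close>, which yields the
          uniformity.\<close>
        then have "real n * L y \<le> real n * L (x n)" by (intro mult_left_mono L_anti) auto
        then show "real n * L y \<le> \<delta>" using elim by linarith
      qed (use elim in auto)
    qed
  qed
  have "(\<lambda>n. SUP y\<in>{x n..}. ereal (g n y)) \<longlonglongrightarrow> 0"
  proof (rule order_tendstoI)
    fix a :: ereal assume "a < 0"
    moreover have "0 \<le> (SUP y\<in>{x n..}. ereal (g n y))" for n
      by (rule SUP_upper2[of "x n"]) (auto simp: g_def)
    ultimately show "\<forall>\<^sub>F n in sequentially. a < (SUP y\<in>{x n..}. ereal (g n y))"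
      by (intro always_eventually allI) (rule less_le_trans)
  next
    fix a :: ereal assume "0 < a"
    then obtain e where e: "0 < ereal e" "ereal e < a" using ereal_dense2 by blast
    have "\<forall>\<^sub>F n in sequentially. \<forall>y\<ge>x n. g n y \<le> e" by (rule unif) (use e in simp)
    then show "\<forall>\<^sub>F n in sequentially. (SUP y\<in>{x n..}. ereal (g n y)) < a"
    proof eventually_elim
      case (elim n)
      have "(SUP y\<in>{x n..}. ereal (g n y)) \<le> ereal e" by (rule SUP_least) (use elim in auto)
      then show ?case using e(2) by (rule le_less_trans)
    qed
  qed
  then show ?thesis by (simp add: g_def)
qed

end
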